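(* Let $f:\mathbb{R}^N\to\mathbb{R}$ be convex and differentiable, let $\psi(x)=\sum_{i=1}^n\psi^i(x^i)$ with each $\psi^i:\mathbb{R}^{N_i}\to\mathbb{R}\cup\{+\infty\}$ convex and closed, and let $F=f+\psi$. Let $\hat S$ be an arbitrary proper sampling with probability vector $p=(p_1,\dots,p_n)$ and let $v\in\mathbb{R}^n_{++}$ be such that $(f,\hat S)\sim ESO(v)$. Choose $\theta_0\in(0,\min_ip_i]$ and set $\theta_k=\theta_0$ for all $k\ge0$. Then for any $y\in\mathbb{R}^N$, the iterates $\{x_k\}_{k\ge1}$ of the ALPHA algorithm satisfy, for all $k\ge1$, $$\max\Big\{\mathbf{E}[F(\hat x_k)],\ \min_{l=1,\dots,k}\mathbf{E}[F(x_l)]\Big\}-F(y)\ \le\ \frac{C}{(k-1)\theta_0+1},$$ where $$\hat x_k=\frac{x_k+\theta_0\sum_{l=1}^{k-1}x_l}{1+(k-1)\theta_0},\qquad C=(1-\theta_0)\big(F(x_0)-F(y)\big)+\frac{\theta_0^2}{2}\|x_0-y\|^2_{v\circ p^{-2}}.$$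
   Context: Block structure: $\mathbb{R}^N=\mathbb{R}^{N_1}\times\dots\times\mathbb{R}^{N_n}$, $[n]=\{1,\dots,n\}$; $x^i\in\mathbb{R}^{N_i}$ is the $i$th block of $x\in\mathbb{R}^N$, and $U_i$ is the $N\times N_i$ column submatrix of the identity with $x^i=U_i^\top x$. For $S\subseteq[n]$, $h_{[S]}=\sum_{i\in S}U_ih^i$. $\nabla_i f(x)=U_i^\top\nabla f(x)$. $\langle\cdot,\cdot\rangle$ is the standard inner product. For each $i$, $B_i$ is a fixed (symmetric) positive definite $N_i\times N_i$ matrix and $\|x^i\|_i^2=\langle B_ix^i,x^i\rangle$. For $w\in\mathbb{R}^n_{++}$ (vectors with positive entries): $\langle x,y\rangle_w=\sum_i w_i\langle x^i,y^i\rangle$ and $\|x\|_w^2=\sum_i w_i\|x^i\|_i^2$. For vectors in $\mathbb{R}^n$: $\circ$ is the elementwise product, and $p^{-1},p^{-2}$ are elementwise powers. For $u\in\mathbb{R}^n$, $x\in\mathbb{R}^N$: $u\cdot x=\sum_i u_iU_ix^i$. $\mathrm{dom}\,\psi=\{x:\psi(x)<+\infty\}$. Sampling: a sampling $\hat S$ is a random subset of $[n]$; $p_i=\mathrm{Prob}(i\in\hat S)$; it is proper if $p_i>0$ for all $i$. ESO: $(f,\hat S)\sim ESO(v)$ means that for all $x,h\in\mathbb{R}^N$, $\mathbf{E}[f(x+h_{[\hat S]})]\le f(x)+\langle\nabla f(x),h\rangle_p+\frac12\|h\|^2_{v\circ p}$. ALPHA algorithm (parameters $\hat S,v,\{\theta_k\}_{k\ge0}$):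 choose $x_0\in\mathrm{dom}\,\psi$, set $z_0=x_0$. For $k\ge0$: $y_k=(1-\theta_k)x_k+\theta_kz_k$; draw a random set $S_k$ with the distribution of $\hat S$, independently of the past; set $z_{k+1}^i=\arg\min_{z\in\mathbb{R}^{N_i}}\{\langle\nabla_if(y_k),z\rangle+\frac{\theta_kv_i}{2p_i}\|z-z_k^i\|_i^2+\psi^i(z)\}$ for $i\in S_k$ and $z_{k+1}^i=z_k^i$ for $i\notin S_k$; set $x_{k+1}=y_k+\theta_kp^{-1}\cdot(z_{k+1}-z_k)$. *)

theory Defs
  imports "HOL-Probability.Probability"
begin

section \<open>Block structure\<close>

text \<open>
  The coordinates are indexed by \<open>'m\<close> (\<open>N = CARD('m)\<close>), the blocks by \<open>'n\<close>
  (\<open>n = CARD('n)\<close>), and \<open>b j\<close> is the block containing coordinate \<open>j\<close>.  Thus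
  \<open>U\<^sub>i\<close> consists of the columns \<open>j\<close> of the identity with \<open>b j = i\<close>, and \<open>N\<^sub>i\<close> is the
  number of these columns.  As \<open>N\<^sub>i\<close> varies with \<open>i\<close>, the space of the \<open>i\<close>th block is
  identified with the range \<open>block_space b i\<close> of \<open>U\<^sub>i\<close>; accordingly \<open>block b i x\<close>
  is \<open>U\<^sub>i x\<^sup>i\<close> and plays the role of \<open>x\<^sup>i\<close>, too.
\<close>

definition block_space :: "('m \<Rightarrow> 'n) \<Rightarrow> 'n \<Rightarrow> (real ^ 'm) set" where
  "block_space b i = {z. \<forall>j. b j \<noteq> i \<longrightarrow> z $ j = 0}"

definition block :: "('m \<Rightarrow> 'n) \<Rightarrow> 'n \<Rightarrow> real ^ 'm \<Rightarrow> real ^ 'm" where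
  "block b i x = (\<chi> j. if b j = i then x $ j else 0)"

definition restrict_blocks :: "('m \<Rightarrow> 'n::finite) \<Rightarrow> 'n set \<Rightarrow> real ^ 'm \<Rightarrow> real ^ 'm" where
  "restrict_blocks b T h = (\<Sum>i\<in>T. block b i h)"

definition scale_blocks :: "('m \<Rightarrow> 'n::finite) \<Rightarrow> ('n \<Rightarrow> real) \<Rightarrow> real ^ 'm \<Rightarrow> real ^ 'm" where
  "scale_blocks b u x = (\<Sum>i\<in>UNIV. u i *\<^sub>R block b i x)"

text \<open>
  \<open>A\<close> encodes an \<open>N\<^sub>i \<times> N\<^sub>i\<close> matrix by its entries whose row and column both belong
  to block \<open>i\<close>; all other entries of \<open>A\<close> are irrelevant.
\<close>

definition block_pos_def :: "('m::finite \<Rightarrow> 'n) \<Rightarrow> 'n \<Rightarrow> real ^ 'm ^ 'm \<Rightarrow> bool" where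
  "block_pos_def b i A \<longleftrightarrow>
     (\<forall>j l. b j = i \<longrightarrow> b l = i \<longrightarrow> A $ j $ l = A $ l $ j) \<and>
     (\<forall>z\<in>block_space b i. z \<noteq> 0 \<longrightarrow> (A *v z) \<bullet> z > 0)"

definition block_norm_sq :: "('n \<Rightarrow> real ^ 'm ^ 'm) \<Rightarrow> 'n \<Rightarrow> real ^ 'm::finite \<Rightarrow> real" where
  "block_norm_sq B i z = (B i *v z) \<bullet> z"

definition weighted_inner ::
  "('m::finite \<Rightarrow> 'n::finite) \<Rightarrow> ('n \<Rightarrow> real) \<Rightarrow> real ^ 'm \<Rightarrow> real ^ 'm \<Rightarrow> real" where
  "weighted_inner b w x y = (\<Sum>i\<in>UNIV. w i * (block b i x \<bullet> block b i y))"

definition weighted_norm_sq ::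
  "('m::finite \<Rightarrow> 'n::finite) \<Rightarrow> ('n \<Rightarrow> real ^ 'm ^ 'm) \<Rightarrow> ('n \<Rightarrow> real) \<Rightarrow> real ^ 'm \<Rightarrow> real" where
  "weighted_norm_sq b B w x = (\<Sum>i\<in>UNIV. w i * block_norm_sq B i (block b i x))"


section \<open>Gradients and extended-valued convex functions\<close>

definition grad :: "('a::real_inner \<Rightarrow> real) \<Rightarrow> 'a \<Rightarrow> 'a" where
  "grad f x = (THE D. GDERIV f x :> D)"

lemma gderiv_grad:
  fixes f :: "'a::euclidean_space \<Rightarrow> real"
  assumes "f differentiable (at x)"
  shows "GDERIV f x :> grad f x"
proof -
  obtain f' where f': "(f has_derivative f') (at x)"
    using assms by (auto simp: differentiable_def)
  then interpret f': bounded_linear f' by (rule has_derivative_bounded_linear)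
  define D where "D = (\<Sum>e\<in>Basis. f' e *\<^sub>R e)"
  have "f' h = h \<bullet> D" for h
  proof -
    have "f' h = f' (\<Sum>e\<in>Basis. (h \<bullet> e) *\<^sub>R e)"
      by (simp add: euclidean_representation)
    also have "\<dots> = h \<bullet> D"
      by (simp add: D_def f'.sum f'.scaleR inner_sum_right mult.commute)
    finally show ?thesis .
  qed
  then have "f' = (\<lambda>h. h \<bullet> D)" by (rule ext)
  with f' have D: "GDERIV f x :> D"
    by (simp only: gderiv_def)
  have "E = D" if "GDERIV f x :> E" for E
  proof -
    have "(\<lambda>h. h \<bullet> E) = (\<lambda>h. h \<bullet> D)"
      using that D unfolding gderiv_def by (rule has_derivative_unique)
    then have "\<forall>h. h \<bullet> E = h \<bullet> D" by (simp add: fun_eq_iff)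
    then show ?thesis by (simp only: vector_eq_ldot)
  qed
  with D show ?thesis
    unfolding grad_def by (rule theI)
qed

definition ereal_convex_on :: "'a::real_vector set \<Rightarrow> ('a \<Rightarrow> ereal) \<Rightarrow> bool" where
  "ereal_convex_on V g \<longleftrightarrow> convex V \<and>
     (\<forall>x\<in>V. \<forall>y\<in>V. \<forall>t\<in>{0..1}.
        g ((1 - t) *\<^sub>R x + t *\<^sub>R y) \<le> ereal (1 - t) * g x + ereal t * g y)"

text \<open>A function is closed if its epigraph is.\<close>

definition ereal_closed_on :: "'a::topological_space set \<Rightarrow> ('a \<Rightarrow> ereal) \<Rightarrow> bool" where
  "ereal_closed_on V g \<longleftrightarrow> closed {(x, r). x \<in> V \<and> g x \<le> ereal r}"

definition block_sum ::
  "('m \<Rightarrow> 'n::finite) \<Rightarrow> ('n \<Rightarrow> real ^ 'm \<Rightarrow> ereal) \<Rightarrow> real ^ 'm \<Rightarrow> ereal" where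
  "block_sum b \<psi> x = (\<Sum>i\<in>UNIV. \<psi> i (block b i x))"

definition eff_dom :: "('a \<Rightarrow> ereal) \<Rightarrow> 'a set" where
  "eff_dom g = {x. g x < \<infinity>}"

text \<open>
  Expectation of an extended-valued random variable, as the difference of the
  expectations of its positive and negative parts (\<open>e2ennreal\<close> maps negative numbers
  to 0; the ill-defined case takes the value \<open>\<infinity> - \<infinity> = \<infinity>\<close>).
\<close>

definition ereal_expectation :: "'w measure \<Rightarrow> ('w \<Rightarrow> ereal) \<Rightarrow> ereal" where
  "ereal_expectation M X =
     enn2ereal (\<integral>\<^sup>+\<omega>. e2ennreal (X \<omega>) \<partial>M) - enn2ereal (\<integral>\<^sup>+\<omega>. e2ennreal (- X \<omega>) \<partial>M)"

lemma ereal_expectation_real: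
  assumes "integrable M X"
  shows "ereal_expectation M (\<lambda>\<omega>. ereal (X \<omega>)) = ereal (integral\<^sup>L M X)"
proof -
  have e: "e2ennreal (ereal r) = ennreal r" for r
    by (simp add: ennreal.abs_eq e2ennreal_ereal)
  have r: "enn2ereal a = ereal (enn2real a)" if "a \<noteq> \<infinity>" for a
    using that by (cases a) simp_all
  have "(\<integral>\<^sup>+\<omega>. ennreal (X \<omega>) \<partial>M) \<noteq> \<infinity>" "(\<integral>\<^sup>+\<omega>. ennreal (- X \<omega>) \<partial>M) \<noteq> \<infinity>"
    using assms by (simp_all only: real_integrable_def not_False_eq_True)
  from this[THEN r] show ?thesis
    using assms by (simp only: ereal_expectation_def real_lebesgue_integral_def e uminus_ereal.simps ereal_minus)
qed


section \<open>Samplings and expected separable overapproximation\<close>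

text \<open>A sampling is represented by its distribution on the sets of blocks.\<close>

definition incl_prob :: "'n set pmf \<Rightarrow> 'n \<Rightarrow> real" where
  "incl_prob Shat i = measure_pmf.prob Shat {T. i \<in> T}"

definition proper_sampling :: "'n set pmf \<Rightarrow> bool" where
  "proper_sampling Shat \<longleftrightarrow> (\<forall>i. incl_prob Shat i > 0)"

definition ESO ::
  "('m::finite \<Rightarrow> 'n::finite) \<Rightarrow> ('n \<Rightarrow> real ^ 'm ^ 'm) \<Rightarrow> (real ^ 'm \<Rightarrow> real) \<Rightarrow> 'n set pmf \<Rightarrow>
   ('n \<Rightarrow> real) \<Rightarrow> bool" where
  "ESO b B f Shat v \<longleftrightarrow>
     (\<forall>x h. measure_pmf.expectation Shat (\<lambda>T. f (x + restrict_blocks b T h))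
        \<le> f x + weighted_inner b (incl_prob Shat) (grad f x) h
            + 1/2 * weighted_norm_sq b B (\<lambda>i. v i * incl_prob Shat i) h)"


section \<open>The ALPHA algorithm\<close>

definition alpha_z ::
  "('m::finite \<Rightarrow> 'n::finite) \<Rightarrow> ('n \<Rightarrow> real ^ 'm ^ 'm) \<Rightarrow> (real ^ 'm \<Rightarrow> real) \<Rightarrow>
   ('n \<Rightarrow> real ^ 'm \<Rightarrow> ereal) \<Rightarrow> ('n \<Rightarrow> real) \<Rightarrow> ('n \<Rightarrow> real) \<Rightarrow> real \<Rightarrow> 'n set \<Rightarrow>
   real ^ 'm \<Rightarrow> real ^ 'm \<Rightarrow> real ^ 'm" where
  "alpha_z b B f \<psi> p v \<theta> T y z =
     (\<Sum>i\<in>UNIV. if i \<in> T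
        then arg_min_on
               (\<lambda>u. ereal (block b i (grad f y) \<bullet> u
                         + \<theta> * v i / (2 * p i) * block_norm_sq B i (u - block b i z))
                    + \<psi> i u)
               (block_space b i)
        else block b i z)"

text \<open>
  The pair \<open>(x\<^sub>k, z\<^sub>k)\<close>, where \<open>T k\<close> is the (realized) random set drawn in iteration
  \<open>k\<close>.
\<close>

primrec alpha_iter ::
  "('m::finite \<Rightarrow> 'n::finite) \<Rightarrow> ('n \<Rightarrow> real ^ 'm ^ 'm) \<Rightarrow> (real ^ 'm \<Rightarrow> real) \<Rightarrow>
   ('n \<Rightarrow> real ^ 'm \<Rightarrow> ereal) \<Rightarrow> ('n \<Rightarrow> real) \<Rightarrow> ('n \<Rightarrow> real) \<Rightarrow> (nat \<Rightarrow> real) \<Rightarrow> real ^ 'm \<Rightarrow>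
   (nat \<Rightarrow> 'n set) \<Rightarrow> nat \<Rightarrow> (real ^ 'm) \<times> (real ^ 'm)" where
  "alpha_iter b B f \<psi> p v \<theta> x0 T 0 = (x0, x0)"
| "alpha_iter b B f \<psi> p v \<theta> x0 T (Suc k) =
     (let (x, z) = alpha_iter b B f \<psi> p v \<theta> x0 T k;
          y = (1 - \<theta> k) *\<^sub>R x + \<theta> k *\<^sub>R z;
          z' = alpha_z b B f \<psi> p v (\<theta> k) (T k) y z
      in (y + \<theta> k *\<^sub>R scale_blocks b (\<lambda>i. inverse (p i)) (z' - z), z'))"

text \<open>
  \<open>S k\<close> is distributed like the sampling and independent of \<open>S 0, \<dots>, S (k - 1)\<close>.
\<close>

definition iid_samples :: "'w measure \<Rightarrow> 'n set pmf \<Rightarrow> (nat \<Rightarrow> 'w \<Rightarrow> 'n set) \<Rightarrow> bool" where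
  "iid_samples M Shat S \<longleftrightarrow>
     prob_space.indep_vars M (\<lambda>_. count_space UNIV) S UNIV \<and>
     (\<forall>k. distr M (count_space UNIV) (S k) = measure_pmf Shat)"

end

theory Submission
  imports Defs
begin

text \<open>
  Throughout, the step parameter is a constant \<open>\<theta>\<close> with \<open>0 < \<theta> \<le> p i\<close> for all blocks \<open>i\<close>.

  The difficulty is the nonsmooth part.  The update
  \<open>x\<^sub>k\<^sub>+\<^sub>1 = y\<^sub>k + \<theta> p\<^sup>-\<^sup>1 \<cdot> (z\<^sub>k\<^sub>+\<^sub>1 - z\<^sub>k)\<close> overshoots, and \<open>x\<^sub>k\<^sub>+\<^sub>1\<close> is not evidently a
  convex combination of points of the domain of \<open>\<psi>\<close>.  However, with the running averages
  \<open>w\<^sub>0 = x\<^sub>0\<close>, \<open>w\<^sub>k\<^sub>+\<^sub>1 = (1 - \<theta>) w\<^sub>k + \<theta> z\<^sub>k\<close> of the earlier points \<open>z\<close>, each block of \<open>x\<^sub>k\<close> is the convex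
  combination \<open>(\<theta> / p\<^sub>i) z\<^sub>k\<^sup>i + (1 - \<theta> / p\<^sub>i) w\<^sub>k\<^sup>i\<close> (\<open>mix_next\<close>).  This keeps the
  iterates in the domain, and the same combination of the values of \<open>\<psi>\<^sup>i\<close>, called \<open>Psi_mix\<close>, is an
  upper bound of \<open>\<psi>(x\<^sub>k)\<close>.  It behaves well under sampling: the block \<open>z\<^sup>i\<close> is replaced with
  probability \<open>p\<^sub>i\<close>, and the weight \<open>\<theta> / p\<^sub>i\<close> cancels this probability
  (\<open>expect_Psi_mix_next_le\<close>).

  Let \<open>potential\<close> be \<open>f(x\<^sub>k)\<close> plus this upper bound, and let \<open>scaled_dist_sq u z\<close> be
  \<open>\<theta>\<^sup>2 / 2\<close> times the squared distance of \<open>z\<close> and \<open>u\<close> with the weights \<open>v p\<^sup>-\<^sup>2\<close>.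
  Averaging over the next sample only,
    \<open>E [potential' + scaled_dist_sq u z'] \<le> (1 - \<theta>) potential + \<theta> F(u) + scaled_dist_sq u z\<close>
  (\<open>expect_potential_next_le\<close>).  This combines the ESO inequality for
  \<open>h = \<theta> p\<^sup>-\<^sup>1 \<cdot> (full_z - z)\<close>, where \<open>full_z\<close> updates all blocks; the three-point inequality of the
  strongly convex block problems (\<open>minimizer_gap\<close>, \<open>full_z_three_point\<close>); and the tangent
  inequality for \<open>f\<close> at \<open>y\<^sub>k\<close>.

  As the sample of an iteration is independent of the past, the inequality passes to full
  expectations (\<open>expectation_next\<close>).  Summing it over the iterations bounds
  \<open>E [F(x\<^sub>k)] + \<theta> (\<Sum>l=1..k-1. E [F(x\<^sub>l)])\<close>, a sum with total weight \<open>1 + (k - 1) \<theta>\<close>.  The weighted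
  average dominates both the least of its terms and, by convexity, \<open>E [F]\<close> at the averaged iterate.
\<close>

section \<open>Minimization of closed and of strongly convex functions\<close>

text \<open>
  A minimizing sequence has a cluster point, and closedness of the epigraph passes the upper
  bounds of the values on to it.
\<close>

lemma ereal_closed_on_attains_min:
  fixes g :: "'a::metric_space \<Rightarrow> ereal"
  assumes closed: "ereal_closed_on V g" and K: "compact K" "K \<noteq> {}" "K \<subseteq> V"
  shows "\<exists>x\<in>K. \<forall>y\<in>K. g x \<le> g y"
proof -
  obtain u where u: "\<And>n. u n \<in> g ` K" "u \<longlonglongrightarrow> Inf (g ` K)"
    using Inf_as_limit[of "g ` K"] K(2) by auto
  then have "\<forall>n. \<exists>x\<in>K. u n = g x" by auto
  then obtain \<xi> where \<xi>: "\<And>n. \<xi> n \<in> K" "\<And>n. u n = g (\<xi> n)" by metis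
  obtain l \<sigma> where l: "l \<in> K" "strict_mono (\<sigma> :: nat \<Rightarrow> nat)" "(\<xi> \<circ> \<sigma>) \<longlonglongrightarrow> l"
    using K(1) \<xi>(1) unfolding compact_def by metis
  have lim: "(\<lambda>n. g (\<xi> (\<sigma> n))) \<longlonglongrightarrow> Inf (g ` K)"
    using LIMSEQ_subseq_LIMSEQ[OF u(2) l(2)] \<xi>(2) by (simp add: comp_def)
  have "g l \<le> Inf (g ` K)"
  proof (rule ccontr)
    assume "\<not> g l \<le> Inf (g ` K)"
    then obtain c where c: "Inf (g ` K) < ereal c" "ereal c < g l"
      using ereal_dense2 by (metis not_le)
    have ev: "\<forall>\<^sub>F n in sequentially. (\<xi> (\<sigma> n), c) \<in> {(x, r). x \<in> V \<and> g x \<le> ereal r}"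
      using order_tendstoD(2)[OF lim c(1)] by eventually_elim (use \<xi>(1) K(3) in auto)
    have "(\<lambda>n. (\<xi> (\<sigma> n), c)) \<longlonglongrightarrow> (l, c)"
      using l(3) by (intro tendsto_Pair tendsto_const) (simp add: comp_def)
    from Lim_in_closed_set[OF closed[unfolded ereal_closed_on_def] ev _ this]
    have "g l \<le> ereal c" by simp
    with c(2) show False by simp
  qed
  then show ?thesis
    using l(1) by (meson INF_lower order_trans)
qed

text \<open>
  Adding \<open>h\<close> shears the epigraph, and the shear is continuous.
\<close>

lemma ereal_closed_on_add_continuous:
  fixes g :: "'a::t2_space \<Rightarrow> ereal"
  assumes closed: "ereal_closed_on V g" and cont: "continuous_on UNIV h"
  shows "ereal_closed_on V (\<lambda>x. ereal (h x) + g x)"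
proof -
  have eq: "{(x, r). x \<in> V \<and> ereal (h x) + g x \<le> ereal r}
      = (\<lambda>(x, r). (x, r - h x)) -` {(x, r). x \<in> V \<and> g x \<le> ereal r}" (is "?L = ?f -` ?E")
  proof (intro set_eqI)
    fix a :: "'a \<times> real"
    show "a \<in> ?L \<longleftrightarrow> a \<in> ?f -` ?E"
      by (cases a; cases "g (fst a)") (auto simp: algebra_simps)
  qed
  have "continuous_on UNIV ?f"
    unfolding case_prod_beta
    by (intro continuous_intros continuous_on_compose2[OF cont]) auto
  then show ?thesis
    unfolding ereal_closed_on_def eq by (intro closed_vimage closed[unfolded ereal_closed_on_def])
qed

lemma ereal_convex_on_imp_convex_on_real:
  assumes conv: "ereal_convex_on V g" and "\<And>x. x \<in> V \<Longrightarrow> g x \<noteq> -\<infinity>"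
  shows "convex_on {x \<in> V. g x \<noteq> \<infinity>} (\<lambda>x. real_of_ereal (g x))"
proof -
  define D where "D = {x \<in> V. g x \<noteq> \<infinity>}"
  have D: "x \<in> D \<Longrightarrow> g x = ereal (real_of_ereal (g x))" for x
    using assms(2) by (cases "g x") (auto simp: D_def)
  have key: "(1 - t) *\<^sub>R x + t *\<^sub>R y \<in> D \<and> real_of_ereal (g ((1 - t) *\<^sub>R x + t *\<^sub>R y))
      \<le> (1 - t) * real_of_ereal (g x) + t * real_of_ereal (g y)"
    if "x \<in> D" "y \<in> D" "0 \<le> t" "t \<le> 1" for x y t
  proof -
    let ?w = "(1 - t) *\<^sub>R x + t *\<^sub>R y"
    have V: "x \<in> V" "y \<in> V" using that by (auto simp: D_def)
    then have w: "?w \<in> V"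
      using conv that(3,4) by (simp add: ereal_convex_on_def convexD_alt)
    have "g ?w \<le> ereal (1 - t) * g x + ereal t * g y"
      using conv V that(3,4) by (auto simp: ereal_convex_on_def)
    also have "\<dots> = ereal ((1 - t) * real_of_ereal (g x) + t * real_of_ereal (g y))"
      by (subst D[OF that(1)], subst D[OF that(2)]) simp
    finally have le: "g ?w \<le> \<dots>" .
    then have "?w \<in> D" using w by (auto simp: D_def)
    with le D show ?thesis by (metis ereal_less_eq(3))
  qed
  then have "convex D" by (auto simp: convex_alt)
  then show ?thesis
    unfolding D_def[symmetric] using key by (intro convex_onI) (auto simp: less_imp_le)
qed

text \<open>
  The exact convexity defect of a quadratic form; it is the source of strong convexity.
\<close>

lemma quadratic_form_combination:
  fixes A :: "real ^ 'm ^ 'm::finite"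
  shows "(A *v ((1 - t) *\<^sub>R a + t *\<^sub>R c)) \<bullet> ((1 - t) *\<^sub>R a + t *\<^sub>R c)
    = (1 - t) * ((A *v a) \<bullet> a) + t * ((A *v c) \<bullet> c) - t * (1 - t) * ((A *v (a - c)) \<bullet> (a - c))"
  by (simp add: matrix_vector_right_distrib matrix_vector_mult_diff_distrib matrix_vector_mult_scaleR
      inner_add_left inner_add_right inner_diff_left inner_diff_right algebra_simps)

text \<open>
  The form attains a positive minimum on the unit sphere of \<open>V\<close>, and it is homogeneous of degree 2.
\<close>

lemma positive_definite_imp_coercive:
  fixes A :: "real ^ 'm ^ 'm::finite"
  assumes V: "subspace V" and pos: "\<And>z. z \<in> V \<Longrightarrow> z \<noteq> 0 \<Longrightarrow> (A *v z) \<bullet> z > 0"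
  obtains \<mu> where "\<mu> > 0" "\<And>u. u \<in> V \<Longrightarrow> \<mu> * (norm u)\<^sup>2 \<le> (A *v u) \<bullet> u"
proof -
  let ?q = "\<lambda>u. (A *v u) \<bullet> u"
  let ?K = "V \<inter> sphere 0 1"
  have K: "compact ?K"
    by (simp add: V closed_Int_compact closed_subspace)
  have cont: "continuous_on ?K ?q"
    by (intro continuous_intros linear_continuous_on matrix_vector_mul_bounded_linear)
  have "\<exists>\<mu>>0. \<forall>u\<in>?K. \<mu> \<le> ?q u"
  proof (cases "?K = {}")
    case True
    then show ?thesis by (intro exI[of _ 1]) auto
  next
    case False
    from continuous_attains_inf[OF K this cont] obtain s where s: "s \<in> ?K" "\<forall>u\<in>?K. ?q s \<le> ?q u" by auto
    moreover have "?q s > 0" using s(1) by (intro pos) auto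
    ultimately show ?thesis by blast
  qed
  then obtain \<mu> where \<mu>: "\<mu> > 0" "\<And>u. u \<in> ?K \<Longrightarrow> \<mu> \<le> ?q u" by auto
  have "\<mu> * (norm u)\<^sup>2 \<le> ?q u" if u: "u \<in> V" for u
  proof (cases "u = 0")
    case False
    have "(1 / norm u) *\<^sub>R u \<in> ?K"
      using u False V by (auto simp: subspace_scale)
    from \<mu>(2)[OF this] have "\<mu> \<le> ?q u / (norm u)\<^sup>2"
      by (simp add: matrix_vector_mult_scaleR power2_eq_square)
    then show ?thesis using False by (simp add: field_simps)
  qed simp
  with \<mu>(1) show ?thesis using that by blast
qed

text \<open>
  The data of one proximal step: minimize \<open>\<langle>g, u\<rangle> + c \<parallel>u - z\<parallel>\<^sub>A\<^sup>2 + \<psi> u\<close> over a subspace \<open>V\<close>.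
\<close>

locale proximal_step =
  fixes V :: "(real ^ 'm::finite) set" and A :: "real ^ 'm ^ 'm" and \<psi> :: "real ^ 'm \<Rightarrow> ereal"
    and g z :: "real ^ 'm" and c :: real
  assumes subspace_V: "subspace V"
    and A_pos: "\<And>u. u \<in> V \<Longrightarrow> u \<noteq> 0 \<Longrightarrow> (A *v u) \<bullet> u > 0"
    and not_MInf: "\<And>u. u \<in> V \<Longrightarrow> \<psi> u \<noteq> -\<infinity>"
    and convex: "ereal_convex_on V \<psi>"
    and closed: "ereal_closed_on V \<psi>"
    and c_pos: "c > 0"
begin

definition dom :: "(real ^ 'm) set" where
  "dom = {u \<in> V. \<psi> u \<noteq> \<infinity>}"

definition smooth :: "real ^ 'm \<Rightarrow> real" where
  "smooth u = g \<bullet> u + c * ((A *v (u - z)) \<bullet> (u - z))"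

definition obj :: "real ^ 'm \<Rightarrow> ereal" where
  "obj u = ereal (smooth u) + \<psi> u"

definition robj :: "real ^ 'm \<Rightarrow> real" where
  "robj u = smooth u + real_of_ereal (\<psi> u)"

lemma obj_eq: "u \<in> dom \<Longrightarrow> obj u = ereal (robj u)"
  using not_MInf by (cases "\<psi> u") (auto simp: dom_def obj_def robj_def)

lemma obj_not_dom: "u \<in> V \<Longrightarrow> u \<notin> dom \<Longrightarrow> obj u = \<infinity>"
  by (auto simp: dom_def obj_def)

lemma closed_obj: "ereal_closed_on V obj"
proof -
  have "continuous_on UNIV smooth"
    unfolding smooth_def
    by (intro continuous_intros continuous_on_compose2[OF linear_continuous_on[OF matrix_vector_mul_bounded_linear[of A]]])
       auto
  from ereal_closed_on_add_continuous[OF closed this] show ?thesis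
    by (simp add: obj_def[abs_def])
qed

lemma robj_strongly_convex:
  assumes "a \<in> dom" "u \<in> dom" "0 \<le> t" "t \<le> 1"
  shows "(1 - t) *\<^sub>R a + t *\<^sub>R u \<in> dom"
    and "robj ((1 - t) *\<^sub>R a + t *\<^sub>R u)
      \<le> (1 - t) * robj a + t * robj u - c * t * (1 - t) * ((A *v (a - u)) \<bullet> (a - u))"
proof -
  note conv = ereal_convex_on_imp_convex_on_real[OF convex not_MInf, folded dom_def]
  let ?w = "(1 - t) *\<^sub>R a + t *\<^sub>R u"
  show "?w \<in> dom"
    using convex_on_imp_convex[OF conv] assms by (simp add: convexD_alt)
  have wz: "?w - z = (1 - t) *\<^sub>R (a - z) + t *\<^sub>R (u - z)" by (simp add: algebra_simps)
  have au: "a - z - (u - z) = a - u" by simp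
  have "smooth ?w = (1 - t) * smooth a + t * smooth u - c * t * (1 - t) * ((A *v (a - u)) \<bullet> (a - u))"
    unfolding smooth_def wz quadratic_form_combination au
    by (simp add: inner_add_right inner_diff_right algebra_simps)
  then show "robj ?w \<le> (1 - t) * robj a + t * robj u - c * t * (1 - t) * ((A *v (a - u)) \<bullet> (a - u))"
    using convex_onD[OF conv assms(3,4,1,2)] by (simp add: robj_def algebra_simps)
qed

text \<open>
  Closedness yields minimizers on bounded sets only.
  Strong convexity makes the sublevel sets bounded: a lower bound on the unit ball around a point
  \<open>a\<close> of the domain forces every point with a value of at most \<open>obj a\<close> to lie in a fixed ball.
\<close>

lemma minimizer_exists:
  assumes a: "a \<in> dom"
  shows "\<exists>s\<in>V. \<forall>u\<in>V. obj s \<le> obj u"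
proof -
  obtain \<mu> where \<mu>: "\<mu> > 0" "\<And>u. u \<in> V \<Longrightarrow> \<mu> * (norm u)\<^sup>2 \<le> (A *v u) \<bullet> u"
    using positive_definite_imp_coercive[OF subspace_V A_pos] by blast
  have compact: "compact (V \<inter> cball a r)" for r
    by (simp add: closed_Int_compact closed_subspace subspace_V)
  have aV: "a \<in> V" using a by (simp add: dom_def)
  obtain m where m: "m \<in> V" "\<And>u. u \<in> V \<Longrightarrow> dist a u \<le> 1 \<Longrightarrow> obj m \<le> obj u"
    using ereal_closed_on_attains_min[OF closed_obj compact, of 1] aV by fastforce
  have m_dom: "m \<in> dom"
    using m(2)[OF aV] obj_eq[OF a] obj_not_dom[OF m(1)] by fastforce
  define R where "R = 1 + (robj a - robj m) / (c * \<mu>)"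
  have c\<mu>: "c * \<mu> > 0" using c_pos \<mu>(1) by simp
  have "robj m \<le> robj a"
    using m(2)[OF aV] by (simp add: obj_eq a m_dom)
  then have R: "R \<ge> 1" using c\<mu> by (simp add: R_def)
  obtain s where s: "s \<in> V" "\<And>u. u \<in> V \<Longrightarrow> dist a u \<le> R \<Longrightarrow> obj s \<le> obj u"
    using ereal_closed_on_attains_min[OF closed_obj compact, of R] aV R by fastforce
  have "obj s \<le> obj u" if u: "u \<in> V" for u
  proof (rule ccontr)
    assume neg: "\<not> obj s \<le> obj u"
    then have far: "dist a u > R" using s(2)[OF u] by force
    have "obj u < obj a" using neg s(2)[OF aV] R by (simp add: not_le less_le_trans)
    then have u_dom: "u \<in> dom" using obj_not_dom[OF u] by force
    with \<open>obj u < obj a\<close> have less: "robj u < robj a" by (simp add: obj_eq a)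
    define r where "r = dist a u"
    have r: "r > R" "r > 1" using far R by (auto simp: r_def)
    \<comment> \<open>The point of the segment at distance 1 from \<open>a\<close>, where the lower bound \<open>obj m\<close> applies.\<close>
    define w where "w = (1 - 1 / r) *\<^sub>R a + (1 / r) *\<^sub>R u"
    note sc = robj_strongly_convex[OF a u_dom, of "1 / r", folded w_def]
    have w: "w \<in> dom" using sc r by simp
    have "a - w = (1 / r) *\<^sub>R (a - u)" by (simp add: w_def algebra_simps)
    then have "dist a w = 1" using r by (auto simp: dist_norm r_def)
    then have "robj m \<le> robj w"
      using m(2)[of w] w m_dom by (simp add: obj_eq dom_def)
    also have "\<dots> \<le> (1 - 1 / r) * robj a + (1 / r) * robj u
        - c * (1 / r) * (1 - 1 / r) * ((A *v (a - u)) \<bullet> (a - u))"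
      using sc r by simp
    also have "\<dots> \<le> robj a - c * (1 / r) * (1 - 1 / r) * (\<mu> * r\<^sup>2)"
    proof -
      have "(1 / r) * robj u \<le> (1 / r) * robj a" using less r by (simp add: divide_right_mono)
      moreover have "\<mu> * r\<^sup>2 \<le> (A *v (a - u)) \<bullet> (a - u)"
        using \<mu>(2)[of "a - u"] aV u subspace_V by (simp add: subspace_diff r_def dist_norm)
      then have "c * (1 / r) * (1 - 1 / r) * (\<mu> * r\<^sup>2)
          \<le> c * (1 / r) * (1 - 1 / r) * ((A *v (a - u)) \<bullet> (a - u))"
        using c_pos r by (intro mult_left_mono) auto
      ultimately show ?thesis by (simp add: algebra_simps)
    qed
    also have "\<dots> = robj a - c * \<mu> * (r - 1)"
      using r by (simp add: field_simps power2_eq_square)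
    finally have "(r - 1) * (c * \<mu>) \<le> robj a - robj m" by (simp add: mult.commute[of "r - 1"])
    then have "r - 1 \<le> (robj a - robj m) / (c * \<mu>)" using c\<mu> by (simp add: pos_le_divide_eq)
    then have "r \<le> R" by (simp add: R_def)
    with r show False by simp
  qed
  with s(1) show ?thesis by blast
qed

text \<open>
  The value of a strongly convex function at its minimizer undercuts every other value by the
  squared distance: compare with points close to \<open>s\<close> on the segment from \<open>s\<close> to \<open>u\<close>.
\<close>

lemma minimizer_gap:
  assumes s: "s \<in> dom" and min: "\<And>u. u \<in> dom \<Longrightarrow> robj s \<le> robj u" and u: "u \<in> dom"
  shows "robj s + c * ((A *v (s - u)) \<bullet> (s - u)) \<le> robj u"
proof -
  let ?q = "(A *v (s - u)) \<bullet> (s - u)"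
  have "robj s \<le> robj u - c * (1 - t) * ?q" if t: "0 < t" "t \<le> 1" for t
  proof -
    note sc = robj_strongly_convex[OF s u less_imp_le[OF t(1)] t(2)]
    have "robj s \<le> (1 - t) * robj s + t * robj u - c * t * (1 - t) * ?q"
      using min[OF sc(1)] sc(2) by linarith
    then have "t * (robj s) \<le> t * (robj u - c * (1 - t) * ?q)" by (simp add: algebra_simps)
    then show ?thesis using t by simp
  qed
  then have ev: "\<forall>\<^sub>F t in at_right 0. robj s \<le> robj u - c * (1 - t) * ?q"
    unfolding eventually_at_right_field by (intro exI[of _ 1]) auto
  have "((\<lambda>t. robj u - c * (1 - t) * ?q) \<longlongrightarrow> robj u - c * (1 - 0) * ?q) (at_right 0)"
    by (intro tendsto_intros)
  from tendsto_lowerbound[OF this ev] show ?thesis by simp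
qed

lemma arg_min_on_obj:
  fixes s
  assumes "dom \<noteq> {}"
  defines "s \<equiv> arg_min_on obj V"
  shows "s \<in> dom"
    and "\<And>u. u \<in> dom \<Longrightarrow> robj s + c * ((A *v (s - u)) \<bullet> (s - u)) \<le> robj u"
proof -
  obtain a where a: "a \<in> dom" using assms(1) by blast
  have "\<exists>s. is_arg_min obj (\<lambda>u. u \<in> V) s"
    using minimizer_exists[OF a] by (auto simp: is_arg_min_def not_less)
  then have "is_arg_min obj (\<lambda>u. u \<in> V) s"
    unfolding s_def arg_min_on_def arg_min_def by (rule someI_ex)
  then have s: "s \<in> V" "\<And>u. u \<in> V \<Longrightarrow> obj s \<le> obj u"
    by (auto simp: is_arg_min_def not_less)
  show s_dom: "s \<in> dom"
    using s(2)[of a] a obj_eq[OF a] obj_not_dom[OF s(1)] by (fastforce simp: dom_def)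
  have "robj s \<le> robj u" if "u \<in> dom" for u
    using s(2)[of u] that s_dom by (simp add: obj_eq) (simp add: dom_def obj_eq)
  from minimizer_gap[OF s_dom this]
  show "\<And>u. u \<in> dom \<Longrightarrow> robj s + c * ((A *v (s - u)) \<bullet> (s - u)) \<le> robj u" .
qed

end

text \<open>
  Restriction to the line through \<open>x\<close> and \<open>u\<close> reduces this to functions of one real variable.
\<close>

lemma convex_on_above_tangent_grad:
  fixes f :: "'a::euclidean_space \<Rightarrow> real"
  assumes conv: "convex_on UNIV f" and diff: "f differentiable (at x)"
  shows "f x + grad f x \<bullet> (u - x) \<le> f u"
proof -
  define \<gamma> where "\<gamma> t = x + t *\<^sub>R (u - x)" for t :: real
  have "(f has_derivative (\<lambda>h. h \<bullet> grad f x)) (at (\<gamma> 0))"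
    using gderiv_grad[OF diff] by (simp add: gderiv_def \<gamma>_def)
  moreover have "(\<gamma> has_derivative (\<lambda>h. h *\<^sub>R (u - x))) (at 0)"
    unfolding \<gamma>_def by (auto intro!: derivative_eq_intros)
  ultimately have "((\<lambda>t. f (\<gamma> t)) has_derivative (\<lambda>h. (h *\<^sub>R (u - x)) \<bullet> grad f x)) (at 0)"
    by (rule has_derivative_compose[rotated])
  then have deriv: "((\<lambda>t. f (\<gamma> t)) has_real_derivative (grad f x \<bullet> (u - x))) (at 0)"
    by (simp add: has_field_derivative_def inner_commute mult_commute_abs)
  have "convex_on UNIV (\<lambda>t. f (\<gamma> t))"
  proof (rule convex_onI)
    fix t s r :: real assume t: "0 < t" "t < 1"
    have "\<gamma> ((1 - t) *\<^sub>R s + t *\<^sub>R r) = (1 - t) *\<^sub>R \<gamma> s + t *\<^sub>R \<gamma> r"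
      by (simp add: \<gamma>_def algebra_simps)
    then show "f (\<gamma> ((1 - t) *\<^sub>R s + t *\<^sub>R r)) \<le> (1 - t) * f (\<gamma> s) + t * f (\<gamma> r)"
      using convex_onD[OF conv, of t "\<gamma> s" "\<gamma> r"] t by simp
  qed simp
  from convex_on_imp_above_tangent[OF this, of 0 1] deriv
  have "f (\<gamma> 1) - f (\<gamma> 0) \<ge> (grad f x \<bullet> (u - x)) * (1 - 0)" by simp
  then show ?thesis by (simp add: \<gamma>_def)
qed

section \<open>Block decomposition\<close>

lemma block_nth [simp]: "block b i x $ j = (if b j = i then x $ j else 0)"
  by (simp add: block_def)

lemma block_in_block_space [simp]: "block b i x \<in> block_space b i"
  by (simp add: block_space_def)

lemma block_ident: "x \<in> block_space b i \<Longrightarrow> block b i x = x"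
  by (auto simp: vec_eq_iff block_space_def)

lemma block_block: "block b i (block b j x) = (if i = j then block b i x else 0)"
  by (auto simp: vec_eq_iff)

lemma block_add: "block b i (x + y) = block b i x + block b i y"
  and block_diff: "block b i (x - y) = block b i x - block b i y"
  and block_scaleR: "block b i (c *\<^sub>R x) = c *\<^sub>R block b i x"
  by (auto simp: vec_eq_iff)

lemma block_sum_distrib: "block b i (\<Sum>a\<in>I. g a) = (\<Sum>a\<in>I. block b i (g a))"
  by (auto simp: vec_eq_iff)

lemma subspace_block_space: "subspace (block_space b i)"
  by (auto simp: subspace_def block_space_def)

lemma sum_block:
  fixes b :: "'m::finite \<Rightarrow> 'n::finite"
  shows "(\<Sum>i\<in>UNIV. block b i x) = x"
  by (simp add: vec_eq_iff)

lemma block_eqI: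
  fixes x y :: "real ^ 'm"
  assumes "\<And>i. block b i x = block b i y"
  shows "x = y"
proof -
  have "x $ j = y $ j" for j
    using arg_cong[OF assms[of "b j"], of "\<lambda>u. u $ j"] by simp
  then show ?thesis by (simp add: vec_eq_iff)
qed

text \<open>
  A sum with one summand in each block space is the vector assembled from these blocks.  Both
  \<^const>\<open>scale_blocks\<close> and \<^const>\<open>alpha_z\<close> have this form.
\<close>

lemma block_sum_block_space:
  fixes b :: "'m::finite \<Rightarrow> 'n::finite"
  assumes "\<And>i. c i \<in> block_space b i"
  shows "block b i (\<Sum>i\<in>UNIV. c i) = c i"
proof -
  have "block b i (c j) = (if i = j then c i else 0)" for j
    using block_block[of b i j "c j"] assms[THEN block_ident] by (cases "i = j") auto
  then show ?thesis by (simp add: block_sum_distrib)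
qed

lemma block_scale_blocks: "block b i (scale_blocks b u x) = u i *\<^sub>R block b i x"
  unfolding scale_blocks_def
  by (rule block_sum_block_space) (simp add: subspace_scale[OF subspace_block_space])

lemma block_restrict_blocks:
  "block b i (restrict_blocks b T x) = (if i \<in> T then block b i x else 0)"
proof -
  have "restrict_blocks b T x = (\<Sum>j\<in>UNIV. if j \<in> T then block b j x else 0)"
    by (simp add: restrict_blocks_def sum.If_cases)
  then show ?thesis
    by (simp add: block_sum_block_space subspace_0[OF subspace_block_space])
qed

lemma inner_block_right: "u \<in> block_space b i \<Longrightarrow> block b i x \<bullet> u = x \<bullet> u"
  by (auto simp: inner_vec_def block_space_def intro!: sum.cong)

lemma sum_inner_block:
  fixes b :: "'m::finite \<Rightarrow> 'n::finite"
  shows "(\<Sum>i\<in>UNIV. block b i x \<bullet> block b i y) = x \<bullet> y"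
proof -
  have "(\<Sum>i\<in>UNIV. block b i x \<bullet> block b i y) = x \<bullet> (\<Sum>i\<in>UNIV. block b i y)"
    by (simp add: inner_block_right inner_sum_right)
  then show ?thesis by (simp add: sum_block)
qed

lemma block_norm_sq_scaleR: "block_norm_sq B i (c *\<^sub>R z) = c\<^sup>2 * block_norm_sq B i z"
  by (simp add: block_norm_sq_def matrix_vector_mult_scaleR power2_eq_square)

lemma weighted_norm_sq_minus_commute:
  "weighted_norm_sq b B w (x - y) = weighted_norm_sq b B w (y - x)"
proof -
  have "x - y = (-1) *\<^sub>R (y - x)" by simp
  then show ?thesis
    unfolding weighted_norm_sq_def by (simp only: block_scaleR block_norm_sq_scaleR) simp
qed

section \<open>One iteration with a constant step parameter\<close>

locale alpha_method =
  fixes b :: "'m::finite \<Rightarrow> 'n::finite"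
    and B :: "'n \<Rightarrow> real ^ 'm ^ 'm"
    and f :: "real ^ 'm \<Rightarrow> real"
    and \<psi> :: "'n \<Rightarrow> real ^ 'm \<Rightarrow> ereal"
    and Shat :: "'n set pmf"
    and v :: "'n \<Rightarrow> real"
    and \<theta> :: real
  assumes B: "\<And>i. block_pos_def b i (B i)"
    and f_convex: "convex_on UNIV f"
    and f_diff: "\<And>x. f differentiable (at x)"
    and psi_not_MInf: "\<And>i z. z \<in> block_space b i \<Longrightarrow> \<psi> i z \<noteq> -\<infinity>"
    and psi_convex: "\<And>i. ereal_convex_on (block_space b i) (\<psi> i)"
    and psi_closed: "\<And>i. ereal_closed_on (block_space b i) (\<psi> i)"
    and proper: "proper_sampling Shat"
    and v_pos: "\<And>i. v i > 0"
    and ESO: "ESO b B f Shat v"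
    and theta_pos: "\<theta> > 0"
    and theta_le_incl_prob: "\<And>i. \<theta> \<le> incl_prob Shat i"
begin

abbreviation p :: "'n \<Rightarrow> real" where
  "p \<equiv> incl_prob Shat"

lemma p_pos: "p i > 0"
  using proper by (simp add: proper_sampling_def)

lemma theta_div_p: "0 \<le> \<theta> / p i" "\<theta> / p i \<le> 1"
  using theta_pos p_pos[of i] theta_le_incl_prob[of i] by auto

lemma theta_le_1: "\<theta> \<le> 1"
  using theta_le_incl_prob[of undefined] measure_pmf.prob_le_1[of Shat "{T. undefined \<in> T}"]
  unfolding incl_prob_def by (rule order_trans)

text \<open>
  On the domains of the \<open>\<psi> i\<close> all values are finite.  Since the iterates never leave these domains,
  the analysis uses the real functions \<open>rpsi\<close> and \<open>Psi\<close>; extended values return in the final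
  theorem.
\<close>

definition block_dom :: "'n \<Rightarrow> (real ^ 'm) set" where
  "block_dom i = {z \<in> block_space b i. \<psi> i z \<noteq> \<infinity>}"

definition rpsi :: "'n \<Rightarrow> real ^ 'm \<Rightarrow> real" where
  "rpsi i z = real_of_ereal (\<psi> i z)"

definition feasible :: "(real ^ 'm) set" where
  "feasible = {x. \<forall>i. block b i x \<in> block_dom i}"

definition Psi :: "real ^ 'm \<Rightarrow> real" where
  "Psi x = (\<Sum>i\<in>UNIV. rpsi i (block b i x))"

lemma convex_rpsi: "convex_on (block_dom i) (rpsi i)"
  unfolding block_dom_def rpsi_def[abs_def]
  by (intro ereal_convex_on_imp_convex_on_real psi_convex psi_not_MInf)

lemma rpsi_combination:
  assumes "a \<in> block_dom i" "c \<in> block_dom i" "0 \<le> t" "t \<le> 1"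
  shows "t *\<^sub>R a + (1 - t) *\<^sub>R c \<in> block_dom i"
    and "rpsi i (t *\<^sub>R a + (1 - t) *\<^sub>R c) \<le> t * rpsi i a + (1 - t) * rpsi i c"
  using convexD[OF convex_on_imp_convex[OF convex_rpsi] assms(1,2), of t "1 - t"]
    convex_onD[OF convex_rpsi assms(3,4,2,1)] assms(3,4)
  by (auto simp: add.commute)

lemma convex_feasible: "convex feasible"
  by (intro convexI)
     (auto simp: feasible_def block_add block_scaleR
       intro: convexD[OF convex_on_imp_convex[OF convex_rpsi]])

lemma convex_Psi: "convex_on feasible Psi"
proof (rule convex_onI)
  fix t :: real and x y assume t: "0 < t" "t < 1" and xy: "x \<in> feasible" "y \<in> feasible"
  have "Psi ((1 - t) *\<^sub>R x + t *\<^sub>R y)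
      \<le> (\<Sum>i\<in>UNIV. (1 - t) * rpsi i (block b i x) + t * rpsi i (block b i y))"
    unfolding Psi_def block_add block_scaleR
    using xy t by (intro sum_mono convex_onD[OF convex_rpsi]) (auto simp: feasible_def)
  then show "Psi ((1 - t) *\<^sub>R x + t *\<^sub>R y) \<le> (1 - t) * Psi x + t * Psi y"
    by (simp add: Psi_def sum.distrib sum_distrib_left)
qed (rule convex_feasible)

lemma block_sum_feasible: "x \<in> feasible \<Longrightarrow> block_sum b \<psi> x = ereal (Psi x)"
proof -
  assume "x \<in> feasible"
  then have "\<psi> i (block b i x) = ereal (rpsi i (block b i x))" for i
    using psi_not_MInf[OF block_in_block_space, of i x]
    by (cases "\<psi> i (block b i x)") (auto simp: feasible_def block_dom_def rpsi_def)
  then show ?thesis by (simp add: block_sum_def Psi_def)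
qed

lemma block_sum_infeasible:
  assumes "x \<notin> feasible"
  shows "block_sum b \<psi> x = \<infinity>"
  using assms by (auto simp: feasible_def block_dom_def block_sum_def sum_Pinfty)

text \<open>
  The iterate \<open>x\<^sub>k\<close> is \<open>mix z\<^sub>k w\<^sub>k\<close>, and \<open>Psi_mix z\<^sub>k w\<^sub>k\<close> is the upper bound of \<open>Psi x\<^sub>k\<close> that
  convexity gives.  The weights are in \<open>[0, 1]\<close> because \<open>\<theta> \<le> p i\<close>.
\<close>

definition mix :: "real ^ 'm \<Rightarrow> real ^ 'm \<Rightarrow> real ^ 'm" where
  "mix z w = scale_blocks b (\<lambda>i. \<theta> / p i) z + scale_blocks b (\<lambda>i. 1 - \<theta> / p i) w"

definition Psi_mix :: "real ^ 'm \<Rightarrow> real ^ 'm \<Rightarrow> real" where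
  "Psi_mix z w =
    (\<Sum>i\<in>UNIV. \<theta> / p i * rpsi i (block b i z) + (1 - \<theta> / p i) * rpsi i (block b i w))"

lemma block_mix: "block b i (mix z w) = (\<theta> / p i) *\<^sub>R block b i z + (1 - \<theta> / p i) *\<^sub>R block b i w"
  by (simp add: mix_def block_add block_scale_blocks)

lemma mix_same: "mix z z = z" and Psi_mix_same: "Psi_mix z z = Psi z"
  by (rule block_eqI[of b], simp add: block_mix algebra_simps)
     (simp add: Psi_mix_def Psi_def algebra_simps)

lemma mix_feasible: "z \<in> feasible \<Longrightarrow> w \<in> feasible \<Longrightarrow> mix z w \<in> feasible"
  by (simp add: feasible_def block_mix rpsi_combination theta_div_p)

lemma Psi_mix_le: "z \<in> feasible \<Longrightarrow> w \<in> feasible \<Longrightarrow> Psi (mix z w) \<le> Psi_mix z w"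
  unfolding Psi_def Psi_mix_def block_mix
  by (intro sum_mono rpsi_combination theta_div_p) (auto simp: feasible_def)

definition next_z :: "'n set \<Rightarrow> real ^ 'm \<Rightarrow> real ^ 'm \<Rightarrow> real ^ 'm" where
  "next_z T y z = alpha_z b B f \<psi> p v \<theta> T y z"

text \<open>
  The update of all blocks: \<open>next_z T y z\<close> takes from it the blocks in \<open>T\<close>.  It does not depend on
  the sample, which makes expectations over the sample computable.
\<close>

definition full_z :: "real ^ 'm \<Rightarrow> real ^ 'm \<Rightarrow> real ^ 'm" where
  "full_z y z = next_z UNIV y z"

lemma proximal_step_block:
  "proximal_step (block_space b i) (B i) (\<psi> i) (\<theta> * v i / (2 * p i))"
  using B[of i] psi_not_MInf psi_convex psi_closed theta_pos v_pos p_pos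
  by unfold_locales (auto simp: subspace_block_space block_pos_def_def)

lemma block_arg_min:
  fixes y z :: "real ^ 'm"
  assumes "block_dom i \<noteq> {}"
  defines "s \<equiv> arg_min_on (\<lambda>u. ereal (block b i (grad f y) \<bullet> u
        + \<theta> * v i / (2 * p i) * block_norm_sq B i (u - block b i z)) + \<psi> i u) (block_space b i)"
  shows "s \<in> block_dom i"
    and "u \<in> block_dom i \<Longrightarrow>
      grad f y \<bullet> s + \<theta> * v i / (2 * p i) * block_norm_sq B i (s - block b i z) + rpsi i s
        + \<theta> * v i / (2 * p i) * block_norm_sq B i (s - u)
      \<le> grad f y \<bullet> u + \<theta> * v i / (2 * p i) * block_norm_sq B i (u - block b i z) + rpsi i u"
proof -
  interpret P: proximal_step "block_space b i" "B i" "\<psi> i" "block b i (grad f y)" "block b i z"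
    "\<theta> * v i / (2 * p i)"
    by (rule proximal_step_block)
  have dom: "P.dom = block_dom i" by (simp add: P.dom_def block_dom_def)
  have s: "s = arg_min_on P.obj (block_space b i)"
    by (simp add: s_def P.obj_def[abs_def] P.smooth_def block_norm_sq_def)
  have inner: "block b i (grad f y) \<bullet> u = grad f y \<bullet> u" if "u \<in> block_dom i" for u
    using that by (intro inner_block_right) (simp add: block_dom_def)
  show s_dom: "s \<in> block_dom i"
    using P.arg_min_on_obj(1) assms(1) by (simp add: dom s)
  show "grad f y \<bullet> s + \<theta> * v i / (2 * p i) * block_norm_sq B i (s - block b i z) + rpsi i s
        + \<theta> * v i / (2 * p i) * block_norm_sq B i (s - u)
      \<le> grad f y \<bullet> u + \<theta> * v i / (2 * p i) * block_norm_sq B i (u - block b i z) + rpsi i u"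
    if u: "u \<in> block_dom i"
    using P.arg_min_on_obj(2)[of u] u assms(1) inner[OF u] inner[OF s_dom]
    by (simp add: dom P.robj_def P.smooth_def rpsi_def block_norm_sq_def flip: s)
qed

lemma full_z_block:
  assumes z: "z \<in> feasible"
  shows "block b i (full_z y z) \<in> block_dom i"
    and "u \<in> block_dom i \<Longrightarrow>
      grad f y \<bullet> block b i (full_z y z)
        + \<theta> * v i / (2 * p i) * block_norm_sq B i (block b i (full_z y z) - block b i z)
        + rpsi i (block b i (full_z y z))
        + \<theta> * v i / (2 * p i) * block_norm_sq B i (block b i (full_z y z) - u)
      \<le> grad f y \<bullet> u + \<theta> * v i / (2 * p i) * block_norm_sq B i (u - block b i z) + rpsi i u"
    and "block b i (next_z T y z) = (if i \<in> T then block b i (full_z y z) else block b i z)"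
proof -
  let ?s = "\<lambda>i. arg_min_on (\<lambda>u. ereal (block b i (grad f y) \<bullet> u
        + \<theta> * v i / (2 * p i) * block_norm_sq B i (u - block b i z)) + \<psi> i u) (block_space b i)"
  have dom: "block_dom i \<noteq> {}" for i using z by (auto simp: feasible_def)
  have space: "?s i \<in> block_space b i" for i
    using block_arg_min(1)[OF dom, of i y z] by (simp add: block_dom_def)
  have next_block: "block b i (next_z T y z) = (if i \<in> T then ?s i else block b i z)" for T
    unfolding next_z_def alpha_z_def
    by (rule block_sum_block_space) (use space in simp)
  have full_block: "block b i (full_z y z) = ?s i" by (simp add: full_z_def next_block)
  show "block b i (next_z T y z) = (if i \<in> T then block b i (full_z y z) else block b i z)"
    unfolding full_block by (rule next_block)
  show "block b i (full_z y z) \<in> block_dom i"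
    unfolding full_block by (rule block_arg_min(1)[OF dom])
  show "grad f y \<bullet> block b i (full_z y z)
        + \<theta> * v i / (2 * p i) * block_norm_sq B i (block b i (full_z y z) - block b i z)
        + rpsi i (block b i (full_z y z))
        + \<theta> * v i / (2 * p i) * block_norm_sq B i (block b i (full_z y z) - u)
      \<le> grad f y \<bullet> u + \<theta> * v i / (2 * p i) * block_norm_sq B i (u - block b i z) + rpsi i u"
    if "u \<in> block_dom i"
    unfolding full_block by (rule block_arg_min(2)[OF dom that])
qed

lemma next_z_feasible:
  assumes "z \<in> feasible"
  shows "next_z T y z \<in> feasible"
  using assms full_z_block(1,3)[OF assms] by (auto simp: feasible_def)

text \<open>
  The blockwise gap inequalities add up, since the objective of the full update is separable.
\<close>

lemma full_z_three_point:
  assumes z: "z \<in> feasible" and u: "u \<in> feasible"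
  shows "grad f y \<bullet> full_z y z + \<theta> / 2 * weighted_norm_sq b B (\<lambda>i. v i / p i) (full_z y z - z)
      + Psi (full_z y z) + \<theta> / 2 * weighted_norm_sq b B (\<lambda>i. v i / p i) (full_z y z - u)
    \<le> grad f y \<bullet> u + \<theta> / 2 * weighted_norm_sq b B (\<lambda>i. v i / p i) (u - z) + Psi u"
proof -
  let ?n = "\<lambda>i a. \<theta> * v i / (2 * p i) * block_norm_sq B i a"
  have norm: "\<theta> / 2 * weighted_norm_sq b B (\<lambda>i. v i / p i) (a - c)
      = (\<Sum>i\<in>UNIV. ?n i (block b i a - block b i c))" for a c
    by (simp add: weighted_norm_sq_def sum_distrib_left block_diff mult.assoc)
  have inner: "grad f y \<bullet> a = (\<Sum>i\<in>UNIV. grad f y \<bullet> block b i a)" for a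
    by (simp add: sum_block flip: inner_sum_right)
  have "(\<Sum>i\<in>UNIV. grad f y \<bullet> block b i (full_z y z)
        + ?n i (block b i (full_z y z) - block b i z) + rpsi i (block b i (full_z y z))
        + ?n i (block b i (full_z y z) - block b i u))
      \<le> (\<Sum>i\<in>UNIV. grad f y \<bullet> block b i u + ?n i (block b i u - block b i z) + rpsi i (block b i u))"
    using u by (intro sum_mono full_z_block(2)[OF z]) (auto simp: feasible_def)
  then show ?thesis
    unfolding norm inner[of u] inner[of "full_z y z"] Psi_def by (simp add: sum.distrib)
qed

abbreviation expect :: "('n set \<Rightarrow> real) \<Rightarrow> real" where
  "expect \<equiv> measure_pmf.expectation Shat"

lemma integrable_sampling: "integrable (measure_pmf Shat) (h :: 'n set \<Rightarrow> real)"
  by (rule integrable_measure_pmf_finite) simp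

lemma expect_if: "expect (\<lambda>T. if i \<in> T then a else c) = p i * a + (1 - p i) * c"
proof -
  have "(\<lambda>T. if i \<in> T then a else c) = (\<lambda>T. c + (a - c) * indicator {T. i \<in> T} T)"
    by (auto simp: fun_eq_iff)
  then show ?thesis
    by (simp add: integrable_sampling incl_prob_def algebra_simps)
qed

definition scaled_dist_sq :: "real ^ 'm \<Rightarrow> real ^ 'm \<Rightarrow> real" where
  "scaled_dist_sq u z = \<theta>\<^sup>2 / 2 * weighted_norm_sq b B (\<lambda>i. v i * (inverse (p i))\<^sup>2) (z - u)"

lemma scaled_dist_sq_nonneg: "scaled_dist_sq u z \<ge> 0"
proof -
  have "block_norm_sq B i (block b i a) \<ge> 0" for i a
    using B[of i] by (cases "block b i a = 0") (auto simp: block_pos_def_def block_norm_sq_def less_imp_le)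
  then show ?thesis
    using v_pos less_imp_le[OF v_pos]
    by (auto simp: scaled_dist_sq_def weighted_norm_sq_def intro!: mult_nonneg_nonneg sum_nonneg)
qed

text \<open>
  Block \<open>i\<close> changes with probability \<open>p i\<close>, which turns the weight \<open>v i / (p i)\<^sup>2\<close> into \<open>v i / p i\<close>.
  This is the weight in the three-point inequality.
\<close>

lemma expect_scaled_dist_sq_next:
  assumes z: "z \<in> feasible"
  shows "expect (\<lambda>T. scaled_dist_sq u (next_z T y z)) = scaled_dist_sq u z
    + \<theta>\<^sup>2 / 2 * (weighted_norm_sq b B (\<lambda>i. v i / p i) (full_z y z - u)
               - weighted_norm_sq b B (\<lambda>i. v i / p i) (z - u))"
proof -
  let ?n = "\<lambda>i a. block_norm_sq B i (block b i a - block b i u)"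
  let ?w = "\<lambda>i. v i * (inverse (p i))\<^sup>2"
  have dist: "scaled_dist_sq u a = (\<Sum>i\<in>UNIV. \<theta>\<^sup>2 / 2 * (?w i * ?n i a))" for a
    by (simp add: scaled_dist_sq_def weighted_norm_sq_def block_diff sum_distrib_left)
  have "expect (\<lambda>T. scaled_dist_sq u (next_z T y z)) = (\<Sum>i\<in>UNIV. \<theta>\<^sup>2 / 2 * (?w i *
      expect (\<lambda>T. if i \<in> T then ?n i (full_z y z) else ?n i z)))"
    unfolding dist full_z_block(3)[OF z]
    by (simp add: integrable_sampling if_distrib[of "\<lambda>a. block_norm_sq B _ (a - _)"])
  also have "\<dots> = (\<Sum>i\<in>UNIV. \<theta>\<^sup>2 / 2 * (?w i * ?n i z)
      + \<theta>\<^sup>2 / 2 * (v i / p i * ?n i (full_z y z) - v i / p i * ?n i z))"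
    unfolding expect_if
    by (intro sum.cong refl) (use p_pos in \<open>simp add: field_simps power2_eq_square less_imp_neq[symmetric]\<close>)
  also have "\<dots> = scaled_dist_sq u z + \<theta>\<^sup>2 / 2 * (weighted_norm_sq b B (\<lambda>i. v i / p i) (full_z y z - u)
               - weighted_norm_sq b B (\<lambda>i. v i / p i) (z - u))"
    unfolding dist weighted_norm_sq_def block_diff
    by (simp add: sum.distrib sum_subtractf sum_distrib_left right_diff_distrib)
  finally show ?thesis .
qed

text \<open>
  The old block \<open>z\<^sup>i\<close> enters the next mixture in two ways: through the mixture with the weight
  \<open>\<theta> / p i\<close> if the block is not sampled, which contributes \<open>\<theta> (1 - p i) / p i\<close>, and through the new
  average \<open>w\<close>, which contributes \<open>(1 - \<theta> / p i) \<theta>\<close>.  The sum is \<open>(1 - \<theta>)\<close> times its previous weight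
  \<open>\<theta> / p i\<close>, so the whole mixture contracts by the factor \<open>1 - \<theta>\<close>.
\<close>

lemma expect_Psi_mix_next_le:
  assumes z: "z \<in> feasible" and w: "w \<in> feasible"
  shows "expect (\<lambda>T. Psi_mix (next_z T y z) ((1 - \<theta>) *\<^sub>R w + \<theta> *\<^sub>R z))
    \<le> \<theta> * Psi (full_z y z) + (1 - \<theta>) * Psi_mix z w"
proof -
  let ?w = "(1 - \<theta>) *\<^sub>R w + \<theta> *\<^sub>R z"
  have "expect (\<lambda>T. Psi_mix (next_z T y z) ?w) = (\<Sum>i\<in>UNIV.
      \<theta> / p i * expect (\<lambda>T. if i \<in> T then rpsi i (block b i (full_z y z)) else rpsi i (block b i z))
        + (1 - \<theta> / p i) * rpsi i (block b i ?w))"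
    unfolding Psi_mix_def full_z_block(3)[OF z]
    by (simp add: integrable_sampling if_distrib[of "rpsi _"])
  also have "\<dots> \<le> (\<Sum>i\<in>UNIV. \<theta> * rpsi i (block b i (full_z y z))
      + (1 - \<theta>) * (\<theta> / p i * rpsi i (block b i z) + (1 - \<theta> / p i) * rpsi i (block b i w)))"
  proof (rule sum_mono)
    fix i
    let ?F = "rpsi i (block b i (full_z y z))" and ?Z = "rpsi i (block b i z)"
      and ?W = "rpsi i (block b i w)"
    have "rpsi i (block b i ?w) \<le> (1 - \<theta>) * ?W + \<theta> * ?Z"
      using rpsi_combination(2)[of "block b i w" i "block b i z" "1 - \<theta>"] z w theta_pos theta_le_1
      by (simp add: feasible_def block_add block_scaleR)
    then have "(1 - \<theta> / p i) * rpsi i (block b i ?w) \<le> (1 - \<theta> / p i) * ((1 - \<theta>) * ?W + \<theta> * ?Z)"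
      using theta_div_p by (intro mult_left_mono) auto
    moreover have "\<theta> / p i * (p i * ?F + (1 - p i) * ?Z) + (1 - \<theta> / p i) * ((1 - \<theta>) * ?W + \<theta> * ?Z)
        = \<theta> * ?F + (1 - \<theta>) * (\<theta> / p i * ?Z + (1 - \<theta> / p i) * ?W)"
      using p_pos[of i] by (simp add: field_simps)
    ultimately show "\<theta> / p i * expect (\<lambda>T. if i \<in> T then ?F else ?Z) + (1 - \<theta> / p i) * rpsi i (block b i ?w)
        \<le> \<theta> * ?F + (1 - \<theta>) * (\<theta> / p i * ?Z + (1 - \<theta> / p i) * ?W)"
      unfolding expect_if by linarith
  qed
  also have "\<dots> = \<theta> * Psi (full_z y z) + (1 - \<theta>) * Psi_mix z w"
    by (simp add: Psi_def Psi_mix_def sum.distrib flip: sum_distrib_left)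
  finally show ?thesis .
qed

text \<open>
  The negative coefficient \<open>\<theta> - \<theta> / p i\<close> of \<open>z\<^sup>i\<close> in the update is compensated by the share
  \<open>(1 - \<theta>) \<theta> / p i\<close> of \<open>z\<^sup>i\<close> in \<open>(1 - \<theta>) mix z w\<close>: together they are \<open>(1 - \<theta> / p i) \<theta>\<close>, the share
  of \<open>z\<^sup>i\<close> in the new average.
\<close>

lemma mix_next:
  fixes z w z' :: "real ^ 'm"
  defines "y \<equiv> (1 - \<theta>) *\<^sub>R mix z w + \<theta> *\<^sub>R z"
  shows "y + \<theta> *\<^sub>R scale_blocks b (\<lambda>i. inverse (p i)) (z' - z)
    = mix z' ((1 - \<theta>) *\<^sub>R w + \<theta> *\<^sub>R z)"
proof (rule block_eqI[of b])
  fix i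
  show "block b i (y + \<theta> *\<^sub>R scale_blocks b (\<lambda>i. inverse (p i)) (z' - z))
      = block b i (mix z' ((1 - \<theta>) *\<^sub>R w + \<theta> *\<^sub>R z))"
    unfolding y_def block_add block_scaleR block_mix block_scale_blocks block_diff
    by (simp add: divide_inverse algebra_simps)
qed

text \<open>
  The next iterate is \<open>y\<close> plus the sampled blocks of \<open>h = \<theta> p\<^sup>-\<^sup>1 \<cdot> (full_z y z - z)\<close>, so this is the
  ESO inequality; the factor \<open>p\<^sup>-\<^sup>1\<close> cancels the weights \<open>p\<close> in it.
\<close>

lemma expect_f_next_le:
  fixes z w :: "real ^ 'm"
  assumes z: "z \<in> feasible"
  defines "y \<equiv> (1 - \<theta>) *\<^sub>R mix z w + \<theta> *\<^sub>R z"
  shows "expect (\<lambda>T. f (mix (next_z T y z) ((1 - \<theta>) *\<^sub>R w + \<theta> *\<^sub>R z)))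
    \<le> f y + \<theta> * (grad f y \<bullet> (full_z y z - z))
      + \<theta>\<^sup>2 / 2 * weighted_norm_sq b B (\<lambda>i. v i / p i) (full_z y z - z)"
proof -
  define h where "h = \<theta> *\<^sub>R scale_blocks b (\<lambda>i. inverse (p i)) (full_z y z - z)"
  have block_h: "block b i h = (\<theta> / p i) *\<^sub>R block b i (full_z y z - z)" for i
    by (simp add: h_def block_scaleR block_scale_blocks divide_inverse)
  have "mix (next_z T y z) ((1 - \<theta>) *\<^sub>R w + \<theta> *\<^sub>R z) = y + restrict_blocks b T h" for T
    unfolding mix_next[symmetric] y_def[symmetric]
  proof (rule block_eqI[of b])
    fix i
    show "block b i (y + \<theta> *\<^sub>R scale_blocks b (\<lambda>i. inverse (p i)) (next_z T y z - z))
        = block b i (y + restrict_blocks b T h)"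
      by (simp add: block_add block_scaleR block_scale_blocks block_restrict_blocks block_h
          block_diff full_z_block(3)[OF z] divide_inverse)
  qed
  then have "expect (\<lambda>T. f (mix (next_z T y z) ((1 - \<theta>) *\<^sub>R w + \<theta> *\<^sub>R z)))
      \<le> f y + weighted_inner b p (grad f y) h + 1/2 * weighted_norm_sq b B (\<lambda>i. v i * p i) h"
    using ESO by (simp add: ESO_def)
  also have "weighted_inner b p (grad f y) h = \<theta> * (grad f y \<bullet> (full_z y z - z))"
  proof -
    have "p i * (block b i (grad f y) \<bullet> block b i h)
        = \<theta> * (block b i (grad f y) \<bullet> block b i (full_z y z - z))" for i
      using p_pos[of i] by (simp add: block_h)
    then show ?thesis
      by (simp add: weighted_inner_def sum_inner_block flip: sum_distrib_left)
  qed
  also have "weighted_norm_sq b B (\<lambda>i. v i * p i) h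
      = \<theta>\<^sup>2 * weighted_norm_sq b B (\<lambda>i. v i / p i) (full_z y z - z)"
    unfolding weighted_norm_sq_def sum_distrib_left block_h block_norm_sq_scaleR
    by (intro sum.cong refl) (use p_pos in \<open>simp add: field_simps power2_eq_square less_imp_neq[symmetric]\<close>)
  finally show ?thesis by simp
qed

definition potential :: "real ^ 'm \<Rightarrow> real ^ 'm \<Rightarrow> real" where
  "potential z w = f (mix z w) + Psi_mix z w"

text \<open>
  The key inequality.  The quadratic terms match: the one from ESO is absorbed by the minimization
  property of \<open>full_z\<close>, and the remaining two form the change of \<open>scaled_dist_sq\<close>.  The linear term
  \<open>\<theta> \<langle>\<nabla>f(y), u - z\<rangle>\<close> splits along \<open>\<theta> (u - z) = (1 - \<theta>) (x - y) + \<theta> (u - y)\<close>, so that the tangent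
  inequality applies at \<open>x\<close> and at \<open>u\<close>.
\<close>

lemma expect_potential_next_le:
  fixes z w u :: "real ^ 'm"
  assumes z: "z \<in> feasible" and w: "w \<in> feasible" and u: "u \<in> feasible"
  defines "y \<equiv> (1 - \<theta>) *\<^sub>R mix z w + \<theta> *\<^sub>R z"
  shows "expect (\<lambda>T. potential (next_z T y z) ((1 - \<theta>) *\<^sub>R w + \<theta> *\<^sub>R z) + scaled_dist_sq u (next_z T y z))
    \<le> (1 - \<theta>) * potential z w + \<theta> * (f u + Psi u) + scaled_dist_sq u z"
proof -
  let ?N = "weighted_norm_sq b B (\<lambda>i. v i / p i)"
  let ?g = "grad f y" and ?zt = "full_z y z" and ?x = "mix z w"
  have expect: "expect (\<lambda>T. potential (next_z T y z) ((1 - \<theta>) *\<^sub>R w + \<theta> *\<^sub>R z) + scaled_dist_sq u (next_z T y z))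
      = expect (\<lambda>T. f (mix (next_z T y z) ((1 - \<theta>) *\<^sub>R w + \<theta> *\<^sub>R z)))
        + expect (\<lambda>T. Psi_mix (next_z T y z) ((1 - \<theta>) *\<^sub>R w + \<theta> *\<^sub>R z))
        + expect (\<lambda>T. scaled_dist_sq u (next_z T y z))"
    by (simp add: potential_def integrable_sampling)
  have three: "\<theta> * (?g \<bullet> ?zt) + \<theta>\<^sup>2 / 2 * ?N (?zt - z) + \<theta> * Psi ?zt + \<theta>\<^sup>2 / 2 * ?N (?zt - u)
      \<le> \<theta> * (?g \<bullet> u) + \<theta>\<^sup>2 / 2 * ?N (z - u) + \<theta> * Psi u"
    using mult_left_mono[OF full_z_three_point[OF z u, of y] less_imp_le[OF theta_pos]]
    by (simp add: algebra_simps power2_eq_square weighted_norm_sq_minus_commute[of b B _ u z])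
  have "(1 - \<theta>) * (f y + ?g \<bullet> (?x - y)) \<le> (1 - \<theta>) * f ?x"
    using theta_le_1 by (intro mult_left_mono convex_on_above_tangent_grad f_convex f_diff) auto
  moreover have "\<theta> * (f y + ?g \<bullet> (u - y)) \<le> \<theta> * f u"
    using theta_pos by (intro mult_left_mono convex_on_above_tangent_grad f_convex f_diff) auto
  moreover have "(1 - \<theta>) * (?g \<bullet> (?x - y)) + \<theta> * (?g \<bullet> (u - y)) = \<theta> * (?g \<bullet> (u - z))"
  proof -
    have "(1 - \<theta>) *\<^sub>R (?x - y) + \<theta> *\<^sub>R (u - y) = \<theta> *\<^sub>R (u - z)"
      by (simp add: y_def algebra_simps)
    from arg_cong[OF this, of "inner ?g"] show ?thesis by (simp add: inner_add_right)
  qed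
  ultimately have grad: "f y + \<theta> * (?g \<bullet> (u - z)) \<le> (1 - \<theta>) * f ?x + \<theta> * f u"
    by (simp add: algebra_simps)
  show ?thesis
    unfolding expect expect_scaled_dist_sq_next[OF z] potential_def[of z w]
    using expect_f_next_le[OF z, of w, folded y_def] expect_Psi_mix_next_le[OF z w, of y] three grad
    by (simp add: inner_diff_right algebra_simps)
qed

end

section \<open>Expectations along an independent sequence of samples\<close>

locale iid_sampling = prob_space M
  for M :: "'w measure" +
  fixes Shat :: "'n::finite set pmf" and S :: "nat \<Rightarrow> 'w \<Rightarrow> 'n set"
  assumes iid: "iid_samples M Shat S"
begin

lemma indep: "indep_vars (\<lambda>_. count_space UNIV) S UNIV"
  and distr: "distr M (count_space UNIV) (S k) = measure_pmf Shat"
  using iid by (simp_all add: iid_samples_def)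

lemma S_measurable [measurable]: "S k \<in> measurable M (count_space UNIV)"
  using indep by (simp add: indep_vars_def)

abbreviation past :: "nat \<Rightarrow> 'w \<Rightarrow> nat \<Rightarrow> 'n set" where
  "past k \<omega> \<equiv> restrict (\<lambda>j. S j \<omega>) {..<k}"

lemma PiM_past:
  "PiM {..<k::nat} (\<lambda>_. count_space (UNIV :: 'n set set)) = count_space (PiE {..<k} (\<lambda>_. UNIV))"
  by (rule count_space_PiM_finite) (auto intro: countable_finite)

lemma past_measurable: "past k \<in> measurable M (PiM {..<k} (\<lambda>_. count_space UNIV))"
  by (rule measurable_restrict) simp

text \<open>
  A random variable determined by finitely many samples is simple, as there are finitely many sets
  of blocks.
\<close>

lemma integrable_past: "integrable M (\<lambda>\<omega>. h (past k \<omega>) :: real)"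
proof (rule integrable_const_bound)
  let ?P = "PiE {..<k} (\<lambda>_. UNIV :: 'n set set)"
  have fin: "finite ?P" by (intro finite_PiE) auto
  show "AE \<omega> in M. norm (h (past k \<omega>)) \<le> (\<Sum>T\<in>?P. \<bar>h T\<bar>)"
    using fin by (intro AE_I2) (auto intro!: member_le_sum)
  show "(\<lambda>\<omega>. h (past k \<omega>)) \<in> borel_measurable M"
    by (rule measurable_compose[OF past_measurable]) (simp add: PiM_past)
qed

lemma integrable_prefix:
  fixes h :: "(nat \<Rightarrow> 'n set) \<Rightarrow> real"
  assumes "\<And>T T'. (\<And>j. j < k \<Longrightarrow> T j = T' j) \<Longrightarrow> h T = h T'"
  shows "integrable M (\<lambda>\<omega>. h (\<lambda>j. S j \<omega>))"
proof -
  have "h (\<lambda>j. S j \<omega>) = h (past k \<omega>)" for \<omega> by (rule assms) simp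
  then show ?thesis by (simp add: integrable_past)
qed

text \<open>
  The tower property in elementary form: the sum over the values of \<open>S k\<close> splits the expectation
  into products of independent factors.
\<close>

lemma expectation_next:
  fixes h :: "(nat \<Rightarrow> 'n set) \<Rightarrow> 'n set \<Rightarrow> real"
  assumes prefix: "\<And>T T' A. (\<And>j. j < k \<Longrightarrow> T j = T' j) \<Longrightarrow> h T A = h T' A"
  shows "expectation (\<lambda>\<omega>. h (\<lambda>j. S j \<omega>) (S k \<omega>))
    = expectation (\<lambda>\<omega>. measure_pmf.expectation Shat (h (\<lambda>j. S j \<omega>)))"
proof -
  have h: "h (\<lambda>j. S j \<omega>) A = h (past k \<omega>) A" for \<omega> A by (rule prefix) simp
  have ind: "integrable M (\<lambda>\<omega>. indicator {A} (S k \<omega>) :: real)" for A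
    by (intro integrable_const_bound[where B=1] AE_I2) (auto simp: indicator_def)
  have E_ind: "expectation (\<lambda>\<omega>. indicator {A} (S k \<omega>)) = pmf Shat A" for A
  proof -
    have "expectation (\<lambda>\<omega>. indicator {A} (S k \<omega>) :: real) = (\<integral>T. indicator {A} T \<partial>distr M (count_space UNIV) (S k))"
      by (subst integral_distr) auto
    then show ?thesis by (simp add: distr pmf.rep_eq)
  qed
  have int: "integrable M (\<lambda>\<omega>. h (past k \<omega>) A)" for A by (rule integrable_past)
  have indep_term: "indep_var borel (\<lambda>\<omega>. h (past k \<omega>) A) borel (\<lambda>\<omega>. indicator {A} (S k \<omega>) :: real)" for A
  proof -
    have "indep_var borel ((\<lambda>T. h T A) \<circ> past k) borel ((\<lambda>T. indicator {A} (T k)) \<circ> (\<lambda>\<omega>. restrict (\<lambda>j. S j \<omega>) {k}))"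
      by (rule indep_var_compose[OF indep_var_restrict[OF indep, of "{..<k}" "{k}"]])
         (auto simp: PiM_past)
    then show ?thesis by (simp add: comp_def)
  qed
  have "expectation (\<lambda>\<omega>. h (\<lambda>j. S j \<omega>) (S k \<omega>))
      = expectation (\<lambda>\<omega>. \<Sum>A\<in>UNIV. h (past k \<omega>) A * indicator {A} (S k \<omega>))"
    unfolding h by (intro Bochner_Integration.integral_cong refl) (simp add: indicator_def)
  also have "\<dots> = (\<Sum>A\<in>UNIV. expectation (\<lambda>\<omega>. h (past k \<omega>) A * indicator {A} (S k \<omega>)))"
    by (intro Bochner_Integration.integral_sum indep_var_integrable[OF indep_term] int ind)
  also have "\<dots> = (\<Sum>A\<in>UNIV. expectation (\<lambda>\<omega>. h (past k \<omega>) A) * pmf Shat A)"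
    by (simp only: indep_var_lebesgue_integral[OF indep_term int ind] E_ind)
  also have "\<dots> = expectation (\<lambda>\<omega>. \<Sum>A\<in>UNIV. h (past k \<omega>) A * pmf Shat A)"
    by (simp add: int)
  also have "\<dots> = expectation (\<lambda>\<omega>. measure_pmf.expectation Shat (h (\<lambda>j. S j \<omega>)))"
    unfolding h by (simp add: integral_measure_pmf_real[of UNIV])
  finally show ?thesis .
qed

end

section \<open>Convergence of the iterates\<close>

context alpha_method
begin

text \<open>The pair \<open>(z\<^sub>k, w\<^sub>k)\<close>.\<close>

primrec state :: "real ^ 'm \<Rightarrow> (nat \<Rightarrow> 'n set) \<Rightarrow> nat \<Rightarrow> (real ^ 'm) \<times> (real ^ 'm)" where
  "state x0 T 0 = (x0, x0)"
| "state x0 T (Suc k) =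
    (case state x0 T k of (z, w) \<Rightarrow>
      (next_z (T k) ((1 - \<theta>) *\<^sub>R mix z w + \<theta> *\<^sub>R z) z, (1 - \<theta>) *\<^sub>R w + \<theta> *\<^sub>R z))"

lemma alpha_iter_eq_state:
  "alpha_iter b B f \<psi> p v (\<lambda>_. \<theta>) x0 T k = (case state x0 T k of (z, w) \<Rightarrow> (mix z w, z))"
proof (induction k)
  case 0
  show ?case by (simp add: mix_same)
next
  case (Suc k)
  obtain z w where "state x0 T k = (z, w)" by fastforce
  with Suc show ?case by (simp add: Let_def mix_next flip: next_z_def)
qed

lemma state_feasible:
  assumes "x0 \<in> feasible"
  shows "fst (state x0 T k) \<in> feasible \<and> snd (state x0 T k) \<in> feasible"
proof (induction k)
  case (Suc k)
  obtain z w where zw: "state x0 T k = (z, w)" by fastforce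
  have "(1 - \<theta>) *\<^sub>R w + \<theta> *\<^sub>R z \<in> feasible"
    using Suc zw theta_pos theta_le_1 by (intro convexD[OF convex_feasible]) auto
  then show ?case using Suc zw by (simp add: next_z_feasible)
qed (simp add: assms)

lemma state_prefix:
  assumes "\<And>j. j < k \<Longrightarrow> T j = T' j"
  shows "state x0 T k = state x0 T' k"
  using assms by (induction k) auto

definition x_iter :: "real ^ 'm \<Rightarrow> (nat \<Rightarrow> 'n set) \<Rightarrow> nat \<Rightarrow> real ^ 'm" where
  "x_iter x0 T k = (case state x0 T k of (z, w) \<Rightarrow> mix z w)"

lemma x_iter_feasible: "x0 \<in> feasible \<Longrightarrow> x_iter x0 T k \<in> feasible"
  using state_feasible[of x0 T k] by (auto simp: x_iter_def mix_feasible split: prod.split)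

lemma x_iter_prefix: "(\<And>j. j < k \<Longrightarrow> T j = T' j) \<Longrightarrow> x_iter x0 T k = x_iter x0 T' k"
  unfolding x_iter_def by (simp add: state_prefix[of k T T'])

definition x_avg :: "real ^ 'm \<Rightarrow> (nat \<Rightarrow> 'n set) \<Rightarrow> nat \<Rightarrow> real ^ 'm" where
  "x_avg x0 T k = (1 / (1 + (real k - 1) * \<theta>)) *\<^sub>R
    (x_iter x0 T k + \<theta> *\<^sub>R (\<Sum>l\<in>{1..<k}. x_iter x0 T l))"

lemma x_avg_prefix: "(\<And>j. j < k \<Longrightarrow> T j = T' j) \<Longrightarrow> x_avg x0 T k = x_avg x0 T' k"
  unfolding x_avg_def
  by (intro arg_cong2[where f="scaleR"] arg_cong2[where f="(+)"] sum.cong refl x_iter_prefix) auto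

definition obj :: "real ^ 'm \<Rightarrow> real" where
  "obj x = f x + Psi x"

lemma convex_obj: "convex_on feasible obj"
  unfolding obj_def[abs_def]
  by (intro convex_on_add convex_Psi convex_on_subset[OF f_convex]) (auto simp: convex_feasible)

text \<open>
  The weights \<open>1\<close> of \<open>x\<^sub>k\<close> and \<open>\<theta>\<close> of the \<open>k - 1\<close> earlier iterates sum up to \<open>1 + (k - 1) \<theta>\<close>, so
  the average is a convex combination.
\<close>

lemma
  assumes x0: "x0 \<in> feasible" and k: "k \<ge> 1"
  shows x_avg_feasible: "x_avg x0 T k \<in> feasible"
    and obj_x_avg_le: "obj (x_avg x0 T k)
      \<le> (obj (x_iter x0 T k) + \<theta> * (\<Sum>l\<in>{1..<k}. obj (x_iter x0 T l))) / (1 + (real k - 1) * \<theta>)"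
proof -
  let ?W = "1 + (real k - 1) * \<theta>"
  define a where "a l = (if l = k then 1 else \<theta>) / ?W" for l
  have W: "?W > 0" using k theta_pos by (intro add_pos_nonneg) auto
  have ivl: "{1..k} = insert k {1..<k}" using k by auto
  have a: "a k = 1 / ?W" "\<And>l. l \<in> {1..<k} \<Longrightarrow> a l = \<theta> / ?W" by (auto simp: a_def)
  have avg: "x_avg x0 T k = (\<Sum>l\<in>{1..k}. a l *\<^sub>R x_iter x0 T l)"
    unfolding ivl x_avg_def by (simp add: a scaleR_add_right scaleR_sum_right)
  have sum_a: "(\<Sum>l\<in>{1..k}. a l) = 1"
    unfolding ivl using W k by (simp add: a field_simps of_nat_diff)
  have a_nonneg: "a l \<ge> 0" for l using W theta_pos by (simp add: a_def)
  show "x_avg x0 T k \<in> feasible"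
    unfolding avg using x_iter_feasible[OF x0] a_nonneg
    by (intro convex_sum convex_feasible sum_a) auto
  have "obj (x_avg x0 T k) \<le> (\<Sum>l\<in>{1..k}. a l * obj (x_iter x0 T l))"
    unfolding avg using k x_iter_feasible[OF x0] a_nonneg
    by (intro convex_on_sum[OF _ _ convex_obj sum_a]) auto
  also have "\<dots> = (obj (x_iter x0 T k) + \<theta> * (\<Sum>l\<in>{1..<k}. obj (x_iter x0 T l))) / ?W"
    unfolding ivl by (simp add: a add_divide_distrib sum_distrib_left sum_divide_distrib)
  finally show "obj (x_avg x0 T k) \<le> \<dots>" .
qed

end

locale alpha_run = alpha_method b B f \<psi> Shat v \<theta> + iid_sampling M Shat S
  for b :: "'m::finite \<Rightarrow> 'n::finite" and B f \<psi> Shat v \<theta>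
    and M :: "'w measure" and S +
  fixes x0 :: "real ^ 'm"
  assumes x0: "x0 \<in> feasible"
begin

abbreviation T :: "'w \<Rightarrow> nat \<Rightarrow> 'n set" where
  "T \<omega> \<equiv> \<lambda>j. S j \<omega>"

definition E_potential :: "nat \<Rightarrow> real" where
  "E_potential k = expectation (\<lambda>\<omega>. case state x0 (T \<omega>) k of (z, w) \<Rightarrow> potential z w)"

definition E_scaled_dist_sq :: "real ^ 'm \<Rightarrow> nat \<Rightarrow> real" where
  "E_scaled_dist_sq u k = expectation (\<lambda>\<omega>. scaled_dist_sq u (fst (state x0 (T \<omega>) k)))"

lemma integrable_state: "integrable M (\<lambda>\<omega>. h (state x0 (T \<omega>) k) :: real)"
proof (rule integrable_prefix)
  fix T T' :: "nat \<Rightarrow> 'n set" assume "\<And>j. j < k \<Longrightarrow> T j = T' j"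
  from state_prefix[OF this] show "h (state x0 T k) = h (state x0 T' k)" by simp
qed

lemma integrable_x_iter: "integrable M (\<lambda>\<omega>. h (x_iter x0 (T \<omega>) k) :: real)"
  using integrable_state[of "\<lambda>(z, w). h (mix z w)" k] by (simp add: x_iter_def case_prod_beta)

lemma integrable_x_avg: "integrable M (\<lambda>\<omega>. h (x_avg x0 (T \<omega>) k) :: real)"
proof (rule integrable_prefix)
  fix T T' :: "nat \<Rightarrow> 'n set" assume "\<And>j. j < k \<Longrightarrow> T j = T' j"
  from x_avg_prefix[OF this] show "h (x_avg x0 T k) = h (x_avg x0 T' k)" by simp
qed

lemma E_potential_Suc_le:
  assumes u: "u \<in> feasible"
  shows "E_potential (Suc k) + E_scaled_dist_sq u (Suc k)
    \<le> (1 - \<theta>) * E_potential k + \<theta> * obj u + E_scaled_dist_sq u k"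
proof -
  define h where "h T A = (case state x0 T k of (z, w) \<Rightarrow>
      let z' = next_z A ((1 - \<theta>) *\<^sub>R mix z w + \<theta> *\<^sub>R z) z in
      potential z' ((1 - \<theta>) *\<^sub>R w + \<theta> *\<^sub>R z) + scaled_dist_sq u z')" for T :: "nat \<Rightarrow> 'n set" and A
  let ?z = "\<lambda>\<omega>. fst (state x0 (T \<omega>) k)" and ?w = "\<lambda>\<omega>. snd (state x0 (T \<omega>) k)"
  have int: "integrable M (\<lambda>\<omega>. case state x0 (T \<omega>) k of (z, w) \<Rightarrow> potential z w)"
    "integrable M (\<lambda>\<omega>. scaled_dist_sq u (fst (state x0 (T \<omega>) k)))" for k
    using integrable_state[of "\<lambda>(z, w). potential z w" k] integrable_state[of "\<lambda>s. scaled_dist_sq u (fst s)" k]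
    by simp_all
  have "E_potential (Suc k) + E_scaled_dist_sq u (Suc k) = expectation (\<lambda>\<omega>.
      (case state x0 (T \<omega>) (Suc k) of (z, w) \<Rightarrow> potential z w) + scaled_dist_sq u (fst (state x0 (T \<omega>) (Suc k))))"
    unfolding E_potential_def E_scaled_dist_sq_def using int[of "Suc k"] by (rule Bochner_Integration.integral_add[symmetric])
  also have "\<dots> = expectation (\<lambda>\<omega>. h (T \<omega>) (S k \<omega>))"
    by (simp add: h_def case_prod_beta Let_def)
  also have "\<dots> = expectation (\<lambda>\<omega>. expect (h (T \<omega>)))"
  proof (rule expectation_next)
    fix T T' :: "nat \<Rightarrow> 'n set" and A assume "\<And>j. j < k \<Longrightarrow> T j = T' j"
    from state_prefix[OF this] show "h T A = h T' A" by (simp add: h_def)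
  qed
  also have "\<dots> \<le> expectation (\<lambda>\<omega>. (1 - \<theta>) * (case state x0 (T \<omega>) k of (z, w) \<Rightarrow> potential z w)
      + \<theta> * obj u + scaled_dist_sq u (fst (state x0 (T \<omega>) k)))"
  proof (rule integral_mono)
    show "integrable M (\<lambda>\<omega>. expect (h (T \<omega>)))"
      unfolding h_def by (rule integrable_state)
    show "integrable M (\<lambda>\<omega>. (1 - \<theta>) * (case state x0 (T \<omega>) k of (z, w) \<Rightarrow> potential z w)
      + \<theta> * obj u + scaled_dist_sq u (fst (state x0 (T \<omega>) k)))"
      using int[of k] by simp
    fix \<omega>
    show "expect (h (T \<omega>)) \<le> (1 - \<theta>) * (case state x0 (T \<omega>) k of (z, w) \<Rightarrow> potential z w)
      + \<theta> * obj u + scaled_dist_sq u (fst (state x0 (T \<omega>) k))"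
      using expect_potential_next_le[of "?z \<omega>" "?w \<omega>" u] state_feasible[OF x0, of "T \<omega>" k] u
      by (simp add: h_def[abs_def] Let_def case_prod_beta obj_def)
  qed
  also have "\<dots> = (1 - \<theta>) * E_potential k + \<theta> * obj u + E_scaled_dist_sq u k"
    using int[of k] by (simp add: E_potential_def E_scaled_dist_sq_def prob_space)
  finally show ?thesis .
qed

lemma E_obj_le_E_potential: "expectation (\<lambda>\<omega>. obj (x_iter x0 (T \<omega>) k)) \<le> E_potential k"
  unfolding E_potential_def
proof (rule integral_mono)
  show "integrable M (\<lambda>\<omega>. case state x0 (T \<omega>) k of (z, w) \<Rightarrow> potential z w)"
    using integrable_state[of "\<lambda>(z, w). potential z w" k] by simp
  show "integrable M (\<lambda>\<omega>. obj (x_iter x0 (T \<omega>) k))" by (rule integrable_x_iter)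
  fix \<omega>
  show "obj (x_iter x0 (T \<omega>) k) \<le> (case state x0 (T \<omega>) k of (z, w) \<Rightarrow> potential z w)"
    using state_feasible[OF x0, of "T \<omega>" k]
    by (auto simp: x_iter_def obj_def potential_def Psi_mix_le split: prod.split)
qed

text \<open>
  Telescoping: the step from \<open>l\<close> to \<open>l + 1\<close> leaves a residue of \<open>\<theta> (E_potential l - obj u)\<close>.  The
  first step leaves none, as its factor \<open>1 - \<theta>\<close> stays on the right-hand side.
\<close>

lemma sum_potential_le:
  assumes u: "u \<in> feasible" and k: "k \<ge> 1"
  shows "(E_potential k - obj u) + \<theta> * (\<Sum>l\<in>{1..<k}. E_potential l - obj u)
    \<le> (1 - \<theta>) * (obj x0 - obj u) + scaled_dist_sq u x0"
proof -
  have "(E_potential k - obj u) + \<theta> * (\<Sum>l\<in>{1..<k}. E_potential l - obj u) + E_scaled_dist_sq u k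
      \<le> (1 - \<theta>) * (E_potential 0 - obj u) + E_scaled_dist_sq u 0"
    using k
  proof (induction k rule: dec_induct)
    case base
    show ?case using E_potential_Suc_le[OF u, of 0] by (simp add: algebra_simps)
  next
    case (step k)
    then show ?case using E_potential_Suc_le[OF u, of k] by (simp add: algebra_simps)
  qed
  moreover have "E_scaled_dist_sq u k \<ge> 0"
    unfolding E_scaled_dist_sq_def by (intro Bochner_Integration.integral_nonneg scaled_dist_sq_nonneg)
  moreover have "E_potential 0 = obj x0" "E_scaled_dist_sq u 0 = scaled_dist_sq u x0"
    by (simp_all add: E_potential_def E_scaled_dist_sq_def potential_def mix_same Psi_mix_same obj_def prob_space)
  ultimately show ?thesis by simp
qed

text \<open>
  Division of the telescoped sum by its total weight: the average lies above the smallest of its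
  terms and, by convexity, above the value at the averaged iterate.
\<close>

theorem expectation_bounds:
  assumes u: "u \<in> feasible" and k: "k \<ge> 1"
  defines "bound \<equiv> ((1 - \<theta>) * (obj x0 - obj u) + scaled_dist_sq u x0) / ((real k - 1) * \<theta> + 1)"
  shows "expectation (\<lambda>\<omega>. obj (x_avg x0 (T \<omega>) k)) - obj u \<le> bound"
    and "\<exists>l\<in>{1..k}. expectation (\<lambda>\<omega>. obj (x_iter x0 (T \<omega>) l)) - obj u \<le> bound"
proof -
  let ?E = "\<lambda>l. expectation (\<lambda>\<omega>. obj (x_iter x0 (T \<omega>) l))"
  let ?W = "(real k - 1) * \<theta> + 1"
  have W: "?W > 0" using k theta_pos by (intro add_nonneg_pos) auto
  have W_eq: "?W = 1 + \<theta> * real (card {1..<k})" using k by (simp add: of_nat_diff)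
  have "?E k + \<theta> * (\<Sum>l\<in>{1..<k}. ?E l) \<le> E_potential k + \<theta> * (\<Sum>l\<in>{1..<k}. E_potential l)"
    using theta_pos by (intro add_mono mult_left_mono sum_mono E_obj_le_E_potential) auto
  also have "\<dots> \<le> (1 - \<theta>) * (obj x0 - obj u) + scaled_dist_sq u x0 + ?W * obj u"
    unfolding W_eq using sum_potential_le[OF u k] by (simp add: sum_subtractf algebra_simps)
  also have "(1 - \<theta>) * (obj x0 - obj u) + scaled_dist_sq u x0 = ?W * bound"
  proof -
    have "a = ?W * (a / ?W)" for a using W by simp
    then show ?thesis unfolding bound_def .
  qed
  also have "?W * bound + ?W * obj u = ?W * (bound + obj u)"
    by (simp only: distrib_left)
  finally have sum: "?E k + \<theta> * (\<Sum>l\<in>{1..<k}. ?E l) \<le> ?W * (bound + obj u)" .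
  have "expectation (\<lambda>\<omega>. obj (x_avg x0 (T \<omega>) k))
      \<le> expectation (\<lambda>\<omega>. (obj (x_iter x0 (T \<omega>) k) + \<theta> * (\<Sum>l\<in>{1..<k}. obj (x_iter x0 (T \<omega>) l))) / (1 + (real k - 1) * \<theta>))"
    by (intro integral_mono integrable_x_avg obj_x_avg_le[OF x0 k] integrable_divide
        Bochner_Integration.integrable_add integrable_mult_right Bochner_Integration.integrable_sum integrable_x_iter)
  also have "\<dots> = (?E k + \<theta> * (\<Sum>l\<in>{1..<k}. ?E l)) / ?W"
    by (simp add: integrable_x_iter add.commute)
  also have "\<dots> \<le> bound + obj u"
    using sum W by (simp add: pos_divide_le_eq mult.commute)
  finally show "expectation (\<lambda>\<omega>. obj (x_avg x0 (T \<omega>) k)) - obj u \<le> bound" by simp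
  show "\<exists>l\<in>{1..k}. ?E l - obj u \<le> bound"
  proof (rule ccontr)
    assume "\<not> ?thesis"
    then have less: "bound + obj u < ?E l" if "l \<in> {1..k}" for l using that by force
    have "?W * (bound + obj u) = (bound + obj u) + \<theta> * (\<Sum>l\<in>{1..<k}. bound + obj u)"
      unfolding W_eq by (simp add: algebra_simps)
    also have "\<dots> < ?E k + \<theta> * (\<Sum>l\<in>{1..<k}. ?E l)"
      using less theta_pos k by (intro add_less_le_mono mult_left_mono sum_mono less_imp_le[OF less]) auto
    finally show False using sum by simp
  qed
qed

end

text \<open>
  If \<open>F y\<close> is finite, all quantities are real and the bounds for real expectations apply.
  If \<open>F y = \<infinity>\<close>, the left-hand side is \<open>-\<infinity>\<close> because the expectations are finite: the iterates stay
  in the domain, and each of them takes finitely many values.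
\<close>

theorem theorem3:
  fixes b :: "'m::finite \<Rightarrow> 'n::finite"
    and B :: "'n \<Rightarrow> real ^ 'm ^ 'm"
    and f :: "real ^ 'm \<Rightarrow> real"
    and \<psi> :: "'n \<Rightarrow> real ^ 'm \<Rightarrow> ereal"
    and F :: "real ^ 'm \<Rightarrow> ereal"
    and Shat :: "'n set pmf"
    and p v :: "'n \<Rightarrow> real"
    and \<theta>0 :: real
    and M :: "'w measure"
    and S :: "nat \<Rightarrow> 'w \<Rightarrow> 'n set"
    and x0 y :: "real ^ 'm"
    and x xhat :: "nat \<Rightarrow> 'w \<Rightarrow> real ^ 'm"
    and C :: ereal
    and k :: nat
  assumes b: "surj b"
    and B: "\<And>i. block_pos_def b i (B i)"
    and f_convex: "convex_on UNIV f"
    and f_diff: "\<And>x. f differentiable (at x)"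
    and psi_not_MInf: "\<And>i z. z \<in> block_space b i \<Longrightarrow> \<psi> i z \<noteq> -\<infinity>"
    and psi_convex: "\<And>i. ereal_convex_on (block_space b i) (\<psi> i)"
    and psi_closed: "\<And>i. ereal_closed_on (block_space b i) (\<psi> i)"
    and F: "\<And>x. F x = ereal (f x) + block_sum b \<psi> x"
    and proper: "proper_sampling Shat"
    and p: "p = incl_prob Shat"
    and v: "\<And>i. v i > 0"
    and ESO: "ESO b B f Shat v"
    and theta0: "\<theta>0 \<in> {0<..Min (range p)}"
    and M: "prob_space M"
    and S: "iid_samples M Shat S"
    and x0: "x0 \<in> eff_dom (block_sum b \<psi>)"
    and x: "\<And>k \<omega>. x k \<omega> = fst (alpha_iter b B f \<psi> p v (\<lambda>_. \<theta>0) x0 (\<lambda>j. S j \<omega>) k)"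
    and xhat: "\<And>k \<omega>. xhat k \<omega> =
      (1 / (1 + (real k - 1) * \<theta>0)) *\<^sub>R (x k \<omega> + \<theta>0 *\<^sub>R (\<Sum>l\<in>{1..<k}. x l \<omega>))"
    and C: "C = ereal (1 - \<theta>0) * (F x0 - F y)
      + ereal (\<theta>0\<^sup>2 / 2 * weighted_norm_sq b B (\<lambda>i. v i * (inverse (p i))\<^sup>2) (x0 - y))"
    and k: "k \<ge> 1"
  shows "max (ereal_expectation M (\<lambda>\<omega>. F (xhat k \<omega>)))
             (MIN l\<in>{1..k}. ereal_expectation M (\<lambda>\<omega>. F (x l \<omega>))) - F y
         \<le> C / ereal ((real k - 1) * \<theta>0 + 1)"
proof -
  have theta: "\<theta>0 > 0" "\<theta>0 \<le> incl_prob Shat i" for i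
    using theta0 Min_le[of "range p" "p i"] by (simp_all add: p)
  interpret alpha_method b B f \<psi> Shat v \<theta>0
    by unfold_locales
      (fact B f_convex f_diff psi_not_MInf psi_convex psi_closed proper v ESO theta)+
  interpret prob_space M by (fact M)
  have x0_feasible: "x0 \<in> feasible"
    using x0 block_sum_infeasible[of x0] by (auto simp: eff_dom_def)
  interpret alpha_run b B f \<psi> Shat v \<theta>0 M S x0
    by unfold_locales (fact S x0_feasible)+
  have F_feasible: "F a = ereal (obj a)" if "a \<in> feasible" for a
    using that by (simp add: F block_sum_feasible obj_def)
  have x_eq: "x l \<omega> = x_iter x0 (\<lambda>j. S j \<omega>) l" for l \<omega>
    by (simp add: x p alpha_iter_eq_state x_iter_def case_prod_beta)
  have xhat_eq: "xhat k \<omega> = x_avg x0 (\<lambda>j. S j \<omega>) k" for \<omega>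
    by (simp add: xhat x_eq x_avg_def)
  have E_x: "ereal_expectation M (\<lambda>\<omega>. F (x l \<omega>)) = ereal (expectation (\<lambda>\<omega>. obj (x_iter x0 (\<lambda>j. S j \<omega>) l)))" for l
    by (simp add: x_eq F_feasible x_iter_feasible[OF x0_feasible] ereal_expectation_real integrable_x_iter)
  have E_xhat: "ereal_expectation M (\<lambda>\<omega>. F (xhat k \<omega>)) = ereal (expectation (\<lambda>\<omega>. obj (x_avg x0 (\<lambda>j. S j \<omega>) k)))"
    by (simp add: xhat_eq F_feasible x_avg_feasible[OF x0_feasible k] ereal_expectation_real integrable_x_avg)
  let ?max = "max (ereal_expectation M (\<lambda>\<omega>. F (xhat k \<omega>)))
             (MIN l\<in>{1..k}. ereal_expectation M (\<lambda>\<omega>. F (x l \<omega>)))"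
  have max_le: "?max \<le> ereal c"
    if "expectation (\<lambda>\<omega>. obj (x_avg x0 (\<lambda>j. S j \<omega>) k)) \<le> c"
      "l \<in> {1..k}" "expectation (\<lambda>\<omega>. obj (x_iter x0 (\<lambda>j. S j \<omega>) l)) \<le> c" for c l
  proof (rule max.boundedI)
    show "ereal_expectation M (\<lambda>\<omega>. F (xhat k \<omega>)) \<le> ereal c"
      using that(1) by (simp add: E_xhat)
    have "(MIN l\<in>{1..k}. ereal_expectation M (\<lambda>\<omega>. F (x l \<omega>))) \<le> ereal_expectation M (\<lambda>\<omega>. F (x l \<omega>))"
      using that(2) by (intro Min_le) auto
    also have "\<dots> \<le> ereal c"
      using that(3) by (simp add: E_x)
    finally show "(MIN l\<in>{1..k}. ereal_expectation M (\<lambda>\<omega>. F (x l \<omega>))) \<le> ereal c" .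
  qed
  show ?thesis
  proof (cases "y \<in> feasible")
    case True
    let ?bound = "((1 - \<theta>0) * (obj x0 - obj y) + scaled_dist_sq y x0) / ((real k - 1) * \<theta>0 + 1)"
    have "(real k - 1) * \<theta>0 + 1 > 0" using k theta(1) by (intro add_nonneg_pos) auto
    then have rhs: "C / ereal ((real k - 1) * \<theta>0 + 1) = ereal ?bound"
      by (simp add: C F_feasible x0_feasible True scaled_dist_sq_def p)
    obtain l where "l \<in> {1..k}" "expectation (\<lambda>\<omega>. obj (x_iter x0 (\<lambda>j. S j \<omega>) l)) - obj y \<le> ?bound"
      using expectation_bounds(2)[OF True k] by blast
    then have "?max \<le> ereal (?bound + obj y)"
      using expectation_bounds(1)[OF True k] by (intro max_le) (simp_all add: diff_le_eq)
    then show ?thesis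
      unfolding rhs F_feasible[OF True] by (simp add: ereal_minus_le)
  next
    case False
    then have "F y = \<infinity>" by (simp add: F block_sum_infeasible)
    moreover have "?max < \<infinity>"
    proof (rule le_less_trans)
      show "?max \<le> ereal (max (expectation (\<lambda>\<omega>. obj (x_avg x0 (\<lambda>j. S j \<omega>) k)))
          (expectation (\<lambda>\<omega>. obj (x_iter x0 (\<lambda>j. S j \<omega>) k))))"
        by (rule max_le[of _ k]) (use k in auto)
    qed (simp only: less_ereal.simps)
    ultimately have "?max - F y = -\<infinity>" by (cases ?max) auto
    then show ?thesis by simp
  qed
qed

end
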